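(* Let $X$ be a Hilbert space, $(\mathcal P,d_1)$ and $(\mathcal Q,d_2)$ metric spaces, $f\colon X\times\mathcal P\times\mathcal Q\to X$ a mapping, $g\colon X\times\mathcal P\to\overline{\mathbb R}$ a lower semicontinuous function, and let $\bar v\in f(\bar x,\bar p,\bar q)+\partial_xg(\bar x,\bar p)$, $\hat v:=\bar v-f(\bar x,\bar p,\bar q)$. Assume that $g$ satisfies (A2) and (A3) (see context) and let $\mathcal R$ be the threshold of prox-regularity of $g$ at $(\bar x,\bar p)$ for $\hat v$. For $\lambda>0$ define $$P_\lambda(v,p):=\{x\in X\mid v\in x+\lambda\partial_xg(x,p)\},\quad(v,p)\in X\times\mathcal P.$$ The following assertions are equivalent: (i) Given any $\lambda\in(0,\mathcal R^{-1})$ (with $0^{-1}=\infty$), the mapping $P_\lambda$ has a single-valued localization $\pi_\lambda$ relative to a neighborhood $W\times P\times U$ of $(\lambda\hat v+\bar x,\bar p,\bar x)$ so that $$\|(v_1-v_2)-2\kappa_0[\pi_\lambda(v_1,p_1)-\pi_\lambda(v_2,p_2)]\|\le\|v_1-v_2\|+\ell_0d_1(p_1,p_2)$$ holds for all $(v_1,p_1),(v_2,p_2)\in W\times P$ with some positive constants $\kappa_0$ and $\ell_0$. (ii) The set-valued mapping $K\colon p\mapsto\operatorname{gph}\partial_xg(\cdot,p)\subset X\times X$ is Lipschitz-like around $(\bar p,\bar x,\hat v)$.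
   Context: Notation. $X$ is a real Hilbert space identified with its dual, $\overline{\mathbb R}=(-\infty,\infty]$, $\mathbb B$ is a closed unit ball. Generalized differentiation. For $\varphi\colon X\to\overline{\mathbb R}$ and $\varphi(\bar x)<\infty$, $\hat\partial\varphi(\bar x)=\{v\mid\liminf_{x\to\bar x}\frac{\varphi(x)-\varphi(\bar x)-\langle v,x-\bar x\rangle}{\|x-\bar x\|}\ge0\}$; the limiting subdifferential $\partial\varphi(\bar x)$ is the set of all $v$ for which there are $x_k\to\bar x$ with $\varphi(x_k)\to\varphi(\bar x)$ and $v_k\in\hat\partial\varphi(x_k)$ with $v_k\to v$ weakly. $\partial_xg(x,p)$ is the limiting subdifferential of $g(\cdot,p)$ at $x$, $\operatorname{gph}\partial_xg(\cdot,p)=\{(x,v)\mid v\in\partial_xg(x,p)\}$, and $\operatorname{gph}\partial_xg=\{(x,p,v)\mid v\in\partial_xg(x,p)\}$. Lipschitz-like. A set-valued mapping $F$ from a metric space $(M,d)$ to a normed space is Lipschitz-like around $(\bar m,\bar y)\in\operatorname{gph}F$ if there are $\ell>0$ and neighborhoods $U$ of $\bar m$, $V$ of $\bar y$ with $F(m)\cap V\subset F(m')+\ell d(m,m')\mathbb B$ for all $m,m'\in U$. Assumptions. (A2) $g$ is parametrically continuously prox-regular at $(\bar x,\bar p)$ for $\hat v$, i.e. (a) there are neighborhoods $U$ of $\bar x$, $V$ of $\hat v$, $P$ of $\bar p$ and $\varepsilon,r>0$ with $g(x,p)\ge g(u,p)+\langle v,x-u\rangle-\frac r2\|x-u\|^2$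 for all $x\in U$ whenever $v\in\partial_xg(u,p)\cap V$, $u\in U$, $p\in P$, $g(u,p)\le g(\bar x,\bar p)+\varepsilon$; and (b) $(x,p,v)\mapsto g(x,p)$ is continuous relative to $\operatorname{gph}\partial_xg$ at $(\bar x,\bar p,\hat v)$. The infimum of all $r>0$ for which (a) holds (with some $U,V,P,\varepsilon$) is the threshold of prox-regularity $\mathcal R$ of $g$ at $(\bar x,\bar p)$ for $\hat v$. (A3) The mapping $p\mapsto\operatorname{epi}g(\cdot,p)$ is Lipschitz-like around $(\bar p,(\bar x,g(\bar x,\bar p)))$. A single-valued localization of a set-valued mapping $F$ relative to a neighborhood $A\times B$ of a point of $\operatorname{gph}F$ is a single-valued mapping $\pi\colon A\to B$, defined on all of $A$, with $\operatorname{gph}\pi=\operatorname{gph}F\cap(A\times B)$. *)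

theory Defs
  imports "HOL-Analysis.Analysis"
begin

definition lower_semicontinuous :: "('a::topological_space \<Rightarrow> ereal) \<Rightarrow> bool" where
  "lower_semicontinuous \<phi> \<longleftrightarrow> (\<forall>z. \<phi> z \<le> Liminf (at z) \<phi>)"

text \<open>The library's \<open>epigraph\<close> is only for real-valued functions.\<close>

definition ereal_epigraph :: "('a \<Rightarrow> ereal) \<Rightarrow> ('a \<times> real) set" where
  "ereal_epigraph \<phi> = {(x, \<alpha>). \<phi> x \<le> ereal \<alpha>}"

definition graph_of :: "('m \<Rightarrow> 'y set) \<Rightarrow> ('m \<times> 'y) set" where
  "graph_of F = {(m, y). y \<in> F m}"

text \<open>The two subdifferentials are empty at points where the function is not finite. The quotient
  is taken in the extended reals: its denominator is positive near, but off, the base point, and it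
  is infinite where \<open>\<phi> x = \<infinity>\<close>.\<close>

definition frechet_subdiff :: "('x::real_inner \<Rightarrow> ereal) \<Rightarrow> 'x \<Rightarrow> 'x set" where
  "frechet_subdiff \<phi> u =
     {v. \<bar>\<phi> u\<bar> \<noteq> \<infinity> \<and>
         0 \<le> Liminf (at u) (\<lambda>x. (\<phi> x - \<phi> u - ereal (inner v (x - u))) / ereal (norm (x - u)))}"

definition weakly_converges :: "(nat \<Rightarrow> 'x::real_inner) \<Rightarrow> 'x \<Rightarrow> bool" where
  "weakly_converges w v \<longleftrightarrow> (\<forall>y. (\<lambda>k. inner (w k) y) \<longlonglongrightarrow> inner v y)"

definition limiting_subdiff :: "('x::real_inner \<Rightarrow> ereal) \<Rightarrow> 'x \<Rightarrow> 'x set" where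
  "limiting_subdiff \<phi> u =
     {v. \<bar>\<phi> u\<bar> \<noteq> \<infinity> \<and>
         (\<exists>(x :: nat \<Rightarrow> 'x) w.
            x \<longlonglongrightarrow> u \<and> (\<lambda>k. \<phi> (x k)) \<longlonglongrightarrow> \<phi> u \<and>
            (\<forall>k. w k \<in> frechet_subdiff \<phi> (x k)) \<and> weakly_converges w v)}"

definition partial_subdiff :: "('x::real_inner \<times> 'p \<Rightarrow> ereal) \<Rightarrow> 'x \<Rightarrow> 'p \<Rightarrow> 'x set" where
  "partial_subdiff g x p = limiting_subdiff (\<lambda>u. g (u, p)) x"

text \<open>Neighborhoods are arbitrary sets with the point in their interior; they need not be open.\<close>

definition lipschitz_like ::
    "('m::metric_space \<Rightarrow> 'y::real_normed_vector set) \<Rightarrow> 'm \<Rightarrow> 'y \<Rightarrow> bool" where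
  "lipschitz_like F mbar ybar \<longleftrightarrow>
     (mbar, ybar) \<in> graph_of F \<and>
     (\<exists>l>0. \<exists>U V. mbar \<in> interior U \<and> ybar \<in> interior V \<and>
        (\<forall>m\<in>U. \<forall>m'\<in>U.
           F m \<inter> V \<subseteq> {y + (l * dist m m') *\<^sub>R b | y b. y \<in> F m' \<and> b \<in> cball 0 1}))"

definition prox_regular_with ::
    "('x::real_inner \<times> 'p::metric_space \<Rightarrow> ereal) \<Rightarrow> 'x \<Rightarrow> 'p \<Rightarrow> 'x \<Rightarrow> real \<Rightarrow> bool" where
  "prox_regular_with g xbar pbar vhat r \<longleftrightarrow>
     (\<exists>U V P. \<exists>\<epsilon>>0. xbar \<in> interior U \<and> vhat \<in> interior V \<and> pbar \<in> interior P \<and>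
        (\<forall>u\<in>U. \<forall>p\<in>P. \<forall>v \<in> partial_subdiff g u p \<inter> V.
           g (u, p) \<le> g (xbar, pbar) + ereal \<epsilon> \<longrightarrow>
           (\<forall>x\<in>U. g (x, p) \<ge> g (u, p) + ereal (inner v (x - u)) - ereal (r / 2 * (norm (x - u))\<^sup>2))))"

definition param_cont_prox_regular ::
    "('x::real_inner \<times> 'p::metric_space \<Rightarrow> ereal) \<Rightarrow> 'x \<Rightarrow> 'p \<Rightarrow> 'x \<Rightarrow> bool" where
  "param_cont_prox_regular g xbar pbar vhat \<longleftrightarrow>
     (\<exists>r>0. prox_regular_with g xbar pbar vhat r) \<and>
     continuous (at (xbar, pbar, vhat) within {(x, p, v). v \<in> partial_subdiff g x p})
       (\<lambda>(x, p, v). g (x, p))"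

text \<open>The infimum is over a set bounded below by 0; it is nonempty, so that the real-valued
  \<open>Inf\<close> is meaningful, under parametric continuous prox-regularity.\<close>

definition prox_threshold ::
    "('x::real_inner \<times> 'p::metric_space \<Rightarrow> ereal) \<Rightarrow> 'x \<Rightarrow> 'p \<Rightarrow> 'x \<Rightarrow> real" where
  "prox_threshold g xbar pbar vhat = Inf {r. 0 < r \<and> prox_regular_with g xbar pbar vhat r}"

definition prox_map ::
    "('x::real_inner \<times> 'p \<Rightarrow> ereal) \<Rightarrow> real \<Rightarrow> 'x \<times> 'p \<Rightarrow> 'x set" where
  "prox_map g lam = (\<lambda>(v, p). {x. v \<in> (\<lambda>w. x + lam *\<^sub>R w) ` partial_subdiff g x p})"

text \<open>Only the values of \<open>\<pi>\<close> on \<open>A\<close> matter.\<close>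

definition single_valued_localization ::
    "('m::topological_space \<Rightarrow> 'y::topological_space set) \<Rightarrow> 'm set \<Rightarrow> 'y set \<Rightarrow> 'm \<Rightarrow> 'y \<Rightarrow>
     ('m \<Rightarrow> 'y) \<Rightarrow> bool" where
  "single_valued_localization F A B mbar ybar \<pi> \<longleftrightarrow>
     (mbar, ybar) \<in> graph_of F \<and> mbar \<in> interior A \<and> ybar \<in> interior B \<and>
     \<pi> ` A \<subseteq> B \<and> {(m, \<pi> m) | m. m \<in> A} = graph_of F \<inter> (A \<times> B)"

end

theory Submission
  imports Defs
begin

text \<open>
  Both conditions concern the solutions \<open>x\<close> of \<open>v \<in> x + lam \<partial>\<^sub>x g(x, p)\<close>, and a point \<open>(x, w)\<close> of the graph
  of \<open>\<partial>\<^sub>x g(\<cdot>, p)\<close> is the same thing as a solution \<open>x\<close> for the datum \<open>v = x + lam w\<close>.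

  If the localization \<open>\<pi>\<close> exists, a graph point at \<open>p\<close> is carried to one at \<open>p'\<close> by freezing \<open>v\<close> and
  moving only the parameter: \<open>x' = \<pi>(v, p')\<close>. The estimate with equal data \<open>v\<close> bounds
  \<open>x - x'\<close> by a multiple of the distance of the parameters, and \<open>w - w'\<close> is \<open>(x' - x) / lam\<close>
  (\<open>prox_localization_imp_graph_lipschitz_like\<close>).

  Conversely, \<open>lam\<close> below the inverse of the threshold leaves room for a prox-regularity constant \<open>r\<close>
  with \<open>lam r < 1\<close>. Adding the
  prox-regularity inequality at two graph points with the same \<open>p\<close> makes \<open>\<partial>\<^sub>x g(\<cdot>, p)\<close> locally
  hypomonotone with constant \<open>r\<close>, so that \<open>I + lam \<partial>\<^sub>x g(\<cdot>, p)\<close> is strongly monotone with constant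
  \<open>\<kappa> = 1 - lam r\<close>. In a Hilbert space \<open>\<kappa> |b|\<^sup>2 \<le> \<langle>a, b\<rangle>\<close> is equivalent to \<open>|a - 2 \<kappa> b| \<le> |a|\<close> for
  positive \<open>\<kappa>\<close>, so this is the required estimate when the two parameters agree, and it also
  gives uniqueness. For different parameters, the Lipschitz-like property moves the graph point at
  \<open>p\<^sub>1\<close> to one at \<open>p\<^sub>2\<close>, at a cost proportional to the distance
  (\<open>graph_lipschitz_like_imp_prox_localization\<close>).

  What remains is existence (\<open>resolvent_points_exist\<close>). Solutions are found as minimizers of
  \<open>g(x, p) + |x - v|\<^sup>2 / (2 lam)\<close> over a ball around \<open>xbar\<close>. At the base data this function grows
  quadratically away from \<open>xbar\<close>, and by the Lipschitz-like property of the epigraphs it changes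
  little with \<open>p\<close>, so near-minimizers stay in the interior of the ball. Closed balls are not
  compact in infinite dimension, so that a minimizer is not available directly. A variational principle with quadratic perturbations
  (\<open>quadratic_variational_principle\<close>) provides exact minimizers of slightly perturbed functions, hence
  solutions for data arbitrarily close to \<open>v\<close>; strong monotonicity makes these a Cauchy
  sequence, and the prox-regularity inequality passes to the limit because epigraphs of lower
  semicontinuous functions are closed.
\<close>

section \<open>A variational principle with quadratic perturbations\<close>

lemma near_minimizer_exists:
  fixes F :: "'a \<Rightarrow> real"
  assumes "\<And>x. x \<in> D \<Longrightarrow> b \<le> F x" and "z \<in> D" and "\<eta> > 0"
  obtains z' where "z' \<in> D" "F z' \<le> F z" "\<And>x. x \<in> D \<Longrightarrow> F z' \<le> F x + \<eta>"
proof -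
  have bdd: "bdd_below (F ` D)" using assms(1) by (intro bdd_belowI2)
  have "\<exists>y\<in>F ` D. y < Inf (F ` D) + \<eta>"
    using cInf_lessD[of "F ` D" "Inf (F ` D) + \<eta>"] assms by auto
  then obtain z0 where z0: "z0 \<in> D" "F z0 < Inf (F ` D) + \<eta>" by auto
  have inf: "Inf (F ` D) \<le> F x" if "x \<in> D" for x using bdd that by (simp add: cInf_lower)
  show ?thesis
  proof (cases "F z0 \<le> F z")
    case True
    then show ?thesis using that[of z0] z0 inf by force
  next
    case False
    then show ?thesis using that[of z] z0 inf assms(2) by force
  qed
qed

text \<open>
  This is a form of the Borwein--Preiss principle. Near-minimizers \<open>z n\<close> are chosen one after the
  other, and after each choice the multiple \<open>\<mu> n |x - z n|\<^sup>2\<close> is added to the function. If the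
  tolerances decrease fast enough compared with \<open>\<mu> n\<close>, the sets of points that then do at least as
  well as \<open>z n\<close> shrink to a single point, which minimizes the limit function. Since the total weight of the
  added squares is as small as desired and \<open>D\<close> is bounded, the whole perturbation has a small gradient.

  Up to a constant, the perturbation at stage \<open>n\<close> is \<open>S n |x|\<^sup>2 - 2 \<langle>y n, x\<rangle>\<close> with explicit \<open>S n\<close>, so the
  construction only has to carry the pair \<open>(z n, y n)\<close>. Closedness of the epigraph over \<open>D\<close> replaces lower
  semicontinuity of \<open>\<phi>\<close> and closedness of \<open>D\<close>: it also fits an extended real-valued function restricted
  to its domain.
\<close>

lemma quadratic_variational_principle:
  fixes D :: "'x::{real_inner, complete_space} set" and \<phi> :: "'x \<Rightarrow> real"
  assumes ne: "D \<noteq> {}" and bdd: "bounded D"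
    and epi: "closed {(x, \<alpha>). x \<in> D \<and> \<phi> x \<le> \<alpha>}"
    and low: "\<And>x. x \<in> D \<Longrightarrow> b \<le> \<phi> x" and eps: "\<epsilon> > 0"
  obtains z w where "z \<in> D" "norm w \<le> \<epsilon>"
    "\<And>x. x \<in> D \<Longrightarrow> \<phi> z + inner w (x - z) - \<epsilon> * (norm (x - z))\<^sup>2 \<le> \<phi> x"
proof -
  obtain B where B: "B > 0" "\<And>x. x \<in> D \<Longrightarrow> norm x \<le> B"
    using bdd bounded_pos by blast
  define M where "M = min \<epsilon> (\<epsilon> / (4 * B))"
  have M: "M > 0" "M \<le> \<epsilon>" "4 * M * B \<le> \<epsilon>"
    using eps B(1) by (auto simp: M_def min_def field_simps)
  define \<mu> :: "nat \<Rightarrow> real" where "\<mu> n = M * (1/2) ^ Suc n" for n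
  define S :: "nat \<Rightarrow> real" where "S n = M * (1 - (1/2) ^ n)" for n
  \<comment> \<open>With this tolerance, \<open>\<mu> n |x - z n|\<^sup>2 \<le> \<eta> n\<close> confines \<open>x\<close> to a ball of radius \<open>(1/2)^n\<close>.\<close>
  define \<eta> :: "nat \<Rightarrow> real" where "\<eta> n = \<mu> n * ((1/2) ^ n)\<^sup>2" for n
  have \<mu>: "\<mu> n > 0" for n using M by (simp add: \<mu>_def)
  have \<eta>: "\<eta> n > 0" for n using \<mu>[of n] by (simp add: \<eta>_def)
  have S_Suc: "S (Suc n) = S n + \<mu> n" for n by (simp add: S_def \<mu>_def algebra_simps)
  have S0: "0 \<le> S n" for n using M(1) by (simp add: S_def power_le_one)
  define G where "G n y x = \<phi> x + S n * (norm x)\<^sup>2 - 2 * inner y x" for n y x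
  \<comment> \<open>The last summand does not depend on \<open>x\<close>, so it cancels in every comparison of values.\<close>
  have G_Suc: "G (Suc n) (y + \<mu> n *\<^sub>R z) x
      = G n y x + \<mu> n * (norm (x - z))\<^sup>2 - \<mu> n * (norm z)\<^sup>2" for n y z x
    unfolding G_def S_Suc by (simp add: power2_norm_eq_inner algebra_simps inner_commute)
  have G_low: "b - 2 * (norm y * B) \<le> G n y x" if "x \<in> D" for n y x
  proof -
    have "inner y x \<le> norm y * norm x" by (rule norm_cauchy_schwarz)
    also have "\<dots> \<le> norm y * B" using B(2)[OF that] by (simp add: mult_left_mono)
    finally have "inner y x \<le> norm y * B" .
    moreover have "0 \<le> S n * (norm x)\<^sup>2" using S0 by simp
    ultimately show ?thesis using low[OF that] by (simp add: G_def)
  qed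
  define P where "P n s = (fst s \<in> D \<and> (n = 0 \<longrightarrow> snd s = 0) \<and> (\<forall>x\<in>D. G n (snd s) (fst s) \<le> G n (snd s) x + \<eta> n))"
    for n and s :: "'x \<times> 'x"
  define Q where "Q n s s' = (snd s' = snd s + \<mu> n *\<^sub>R fst s \<and>
      G (Suc n) (snd s') (fst s') \<le> G (Suc n) (snd s') (fst s))" for n and s s' :: "'x \<times> 'x"
  have "\<exists>s. \<forall>n. P n (s n) \<and> Q n (s n) (s (Suc n))"
  proof (rule dependent_nat_choice)
    obtain z where "z \<in> D" using ne by auto
    from near_minimizer_exists[where F = "G 0 0", OF G_low this \<eta>[of 0]]
    obtain z' where "z' \<in> D" "\<And>x. x \<in> D \<Longrightarrow> G 0 0 z' \<le> G 0 0 x + \<eta> 0" by metis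
    then show "\<exists>s. P 0 s" by (intro exI[of _ "(z', 0)"]) (simp add: P_def)
  next
    fix s n assume "P n s"
    then have "fst s \<in> D" by (simp add: P_def)
    from near_minimizer_exists[where F = "G (Suc n) (snd s + \<mu> n *\<^sub>R fst s)", OF G_low this \<eta>[of "Suc n"]]
    obtain z' where "z' \<in> D" 
      "G (Suc n) (snd s + \<mu> n *\<^sub>R fst s) z' \<le> G (Suc n) (snd s + \<mu> n *\<^sub>R fst s) (fst s)"
      "\<And>x. x \<in> D \<Longrightarrow> G (Suc n) (snd s + \<mu> n *\<^sub>R fst s) z' \<le> G (Suc n) (snd s + \<mu> n *\<^sub>R fst s) x + \<eta> (Suc n)"
      by metis
    then show "\<exists>s'. P (Suc n) s' \<and> Q n s s'"
      by (intro exI[of _ "(z', snd s + \<mu> n *\<^sub>R fst s)"]) (simp add: P_def Q_def)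
  qed
  then obtain s where s: "\<And>n. P n (s n)" "\<And>n. Q n (s n) (s (Suc n))" by auto
  define z y where "z n = fst (s n)" and "y n = snd (s n)" for n
  have zD: "z n \<in> D" and near: "x \<in> D \<Longrightarrow> G n (y n) (z n) \<le> G n (y n) x + \<eta> n" for n x
    using s(1)[of n] by (auto simp: P_def z_def y_def)
  have y_Suc: "y (Suc n) = y n + \<mu> n *\<^sub>R z n"
    and z_Suc: "G (Suc n) (y (Suc n)) (z (Suc n)) \<le> G (Suc n) (y (Suc n)) (z n)" for n
    using s(2)[of n] by (auto simp: Q_def z_def y_def)
  define T where "T n = {x \<in> D. G (Suc n) (y (Suc n)) x \<le> G (Suc n) (y (Suc n)) (z n)}" for n
  have T_iff: "x \<in> T n \<longleftrightarrow> x \<in> D \<and> G n (y n) x + \<mu> n * (norm (x - z n))\<^sup>2 \<le> G n (y n) (z n)" for n x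
    by (simp add: T_def y_Suc G_Suc)
  have T_small: "dist x (z n) \<le> (1/2) ^ n" if "x \<in> T n" for n x
  proof -
    have "x \<in> D" using that by (simp add: T_def)
    from near[OF this, of n] that have "\<mu> n * (norm (x - z n))\<^sup>2 \<le> \<mu> n * ((1/2) ^ n)\<^sup>2"
      by (simp add: T_iff \<eta>_def)
    then have "(norm (x - z n))\<^sup>2 \<le> ((1/2) ^ n)\<^sup>2" using \<mu>[of n] by simp
    then show ?thesis unfolding dist_norm by (rule power2_le_imp_le) simp
  qed
  have T_closed: "closed (T n)" for n
  proof -
    define q where "q x = G (Suc n) (y (Suc n)) (z n) - (S (Suc n) * (norm x)\<^sup>2 - 2 * inner (y (Suc n)) x)" for x
    have "T n = (\<lambda>x. (x, q x)) -` {(x, \<alpha>). x \<in> D \<and> \<phi> x \<le> \<alpha>}"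
      by (auto simp: T_def G_def q_def)
    moreover have "closed ((\<lambda>x. (x, q x)) -` {(x, \<alpha>). x \<in> D \<and> \<phi> x \<le> \<alpha>})"
      unfolding q_def by (intro closed_vimage epi continuous_intros)
    ultimately show ?thesis by simp
  qed
  have T_ne: "T n \<noteq> {}" for n using zD[of n] by (auto simp: T_def)
  have T_Suc: "T (Suc n) \<subseteq> T n" for n
  proof
    fix x assume x: "x \<in> T (Suc n)"
    have "0 \<le> \<mu> (Suc n) * (norm (x - z (Suc n)))\<^sup>2" using \<mu>[of "Suc n"] by simp
    then show "x \<in> T n" using x z_Suc[of n] by (auto simp: T_iff[of _ "Suc n"]) (simp add: T_def)
  qed
  have T_anti: "T n \<subseteq> T m" if "m \<le> n" for m n using lift_Suc_antimono_le[of T, OF T_Suc that] .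
  obtain a where a: "\<And>n. a \<in> T n"
  proof (rule decreasing_closed_nest[of T])
    fix e :: real assume "e > 0"
    then obtain n where n: "(1/2::real) ^ n < e / 2"
      using real_arch_pow_inv[of "e/2" "1/2"] by auto
    have "dist x x' < e" if "x \<in> T n" "x' \<in> T n" for x x'
      using T_small[OF that(1)] T_small[OF that(2)] dist_triangle2[of x x' "z n"] n by linarith
    then show "\<exists>n. \<forall>x\<in>T n. \<forall>y\<in>T n. dist x y < e" by blast
  qed (use T_closed T_ne T_anti in auto)
  have aD: "a \<in> D" using a[of 0] by (simp add: T_def)
  \<comment> \<open>The partial sums \<open>y\<close> of the series of \<open>\<mu> n *\<^sub>R z n\<close> are dominated by those of \<open>\<mu>\<close>; this also bounds
    the limit, and with it the gradient \<open>w\<close>.\<close>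
  have y_diff: "norm (y (n + k) - y n) \<le> (S (n + k) - S n) * B" for n k
  proof (induction k)
    case (Suc k)
    have "norm (y (n + Suc k) - y n) \<le> norm (y (n + k) - y n) + norm (\<mu> (n + k) *\<^sub>R z (n + k))"
      using norm_triangle_ineq[of "y (n + k) - y n" "\<mu> (n + k) *\<^sub>R z (n + k)"]
      by (simp add: y_Suc algebra_simps)
    also have "norm (\<mu> (n + k) *\<^sub>R z (n + k)) \<le> \<mu> (n + k) * B"
      using \<mu>[of "n + k"] B(2)[OF zD] by (simp add: mult_left_mono)
    finally show ?case using Suc by (simp add: S_Suc algebra_simps)
  qed simp
  have half_lim: "(\<lambda>n. (1/2::real) ^ n) \<longlonglongrightarrow> 0" by (rule LIMSEQ_realpow_zero) auto
  have "(\<lambda>n. M * (1 - (1/2) ^ n)) \<longlonglongrightarrow> M * (1 - 0)" by (intro tendsto_intros half_lim)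
  then have S_lim: "S \<longlonglongrightarrow> M" by (simp add: S_def[abs_def])
  have "Cauchy y"
  proof (rule CauchyI')
    fix e :: real assume "e > 0"
    have "Cauchy S" using S_lim LIMSEQ_imp_Cauchy by blast
    then obtain N where N: "\<And>m n. m \<ge> N \<Longrightarrow> n \<ge> N \<Longrightarrow> norm (S m - S n) < e / B"
      using CauchyD[of S "e / B"] \<open>e > 0\<close> B(1) by auto
    have "dist (y m) (y n) < e" if "m \<ge> N" "m < n" for m n
    proof -
      have "dist (y m) (y n) \<le> (S n - S m) * B"
        using y_diff[of m "n - m"] that by (simp add: dist_norm norm_minus_commute)
      also have "\<dots> < e"
        using N[of n m] that B(1) by (simp add: field_simps abs_less_iff)
      finally show ?thesis .
    qed
    then show "\<exists>N. \<forall>m\<ge>N. \<forall>n>m. dist (y m) (y n) < e" by blast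
  qed
  then obtain Y where Y: "y \<longlonglongrightarrow> Y" using Cauchy_convergent convergent_def by blast
  have G_lim: "(\<lambda>n. G n (y n) x) \<longlonglongrightarrow> \<phi> x + M * (norm x)\<^sup>2 - 2 * inner Y x" for x
    unfolding G_def by (intro tendsto_intros S_lim Y)
  have \<eta>_lim: "\<eta> \<longlonglongrightarrow> 0"
  proof -
    have "(\<lambda>n. M * ((1/2) * (1/2) ^ n) * ((1/2) ^ n)\<^sup>2) \<longlonglongrightarrow> M * ((1/2) * 0) * 0\<^sup>2"
      by (intro tendsto_intros half_lim)
    then show ?thesis by (simp add: \<eta>_def[abs_def] \<mu>_def)
  qed
  have min: "\<phi> a + M * (norm a)\<^sup>2 - 2 * inner Y a \<le> \<phi> x + M * (norm x)\<^sup>2 - 2 * inner Y x"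
    if "x \<in> D" for x
  proof -
    have "G n (y n) a \<le> G n (y n) x + \<eta> n" for n
    proof -
      have "0 \<le> \<mu> n * (norm (a - z n))\<^sup>2" using \<mu>[of n] by simp
      then show ?thesis using a[of n] near[OF that, of n] by (simp add: T_iff)
    qed
    then show ?thesis
      using LIMSEQ_le[OF G_lim tendsto_add[OF G_lim \<eta>_lim]] by auto
  qed
  \<comment> \<open>Expanding the minimality of \<open>a\<close> around \<open>a\<close> gives this linear term.\<close>
  define w where "w = 2 *\<^sub>R (Y - M *\<^sub>R a)"
  have "norm (y n) \<le> S n * B" for n
    using y_diff[of 0 n] s(1)[of 0] by (simp add: P_def y_def S_def)
  then have "norm Y \<le> M * B"
    using LIMSEQ_le[OF tendsto_norm[OF Y] tendsto_mult_right[OF S_lim, of B]] by auto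
  moreover have "norm (M *\<^sub>R a) \<le> M * B" using M(1) B(2)[OF aD] by simp
  ultimately have "norm w \<le> \<epsilon>"
    using norm_triangle_ineq4[of Y "M *\<^sub>R a"] M(3) by (simp add: w_def)
  moreover have "\<phi> a + inner w (x - a) - \<epsilon> * (norm (x - a))\<^sup>2 \<le> \<phi> x" if "x \<in> D" for x
  proof -
    have "M * (norm (x - a))\<^sup>2 \<le> \<epsilon> * (norm (x - a))\<^sup>2" using M by (simp add: mult_right_mono)
    moreover have "\<phi> a + inner w (x - a) - M * (norm (x - a))\<^sup>2 \<le> \<phi> x"
      using min[OF that] by (simp add: w_def power2_norm_eq_inner algebra_simps inner_commute)
    ultimately show ?thesis by linarith
  qed
  ultimately show ?thesis using that aD by blast
qed

section \<open>Lipschitz-like mappings and subgradients\<close>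

lemma dist_Pair_le: "dist (a, b) (c, d) \<le> dist a c + dist b d"
  by (simp add: dist_prod_def sqrt_sum_squares_le_sum)

lemma mem_thickening_iff:
  fixes A :: "'a::real_normed_vector set"
  assumes "0 \<le> c"
  shows "z \<in> {y + c *\<^sub>R b | y b. y \<in> A \<and> b \<in> cball 0 1} \<longleftrightarrow> (\<exists>y\<in>A. dist z y \<le> c)"
proof
  assume "z \<in> {y + c *\<^sub>R b | y b. y \<in> A \<and> b \<in> cball 0 1}"
  then obtain y b where yb: "z = y + c *\<^sub>R b" "y \<in> A" "norm b \<le> 1" by auto
  then have "dist z y \<le> c * 1" unfolding dist_norm using assms by (simp add: mult_left_le)
  then show "\<exists>y\<in>A. dist z y \<le> c" using yb(2) by auto
next
  assume "\<exists>y\<in>A. dist z y \<le> c"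
  then obtain y where y: "y \<in> A" "norm (z - y) \<le> c" by (auto simp: dist_norm)
  define b where "b = (1 / c) *\<^sub>R (z - y)"
  have "norm b = norm (z - y) / c" using assms by (simp add: b_def)
  then have "norm b \<le> 1"
    using y(2) assms by (cases "c = 0") simp_all
  moreover have "z = y + c *\<^sub>R b" using y(2) by (cases "c = 0") (auto simp: b_def)
  ultimately show "z \<in> {y + c *\<^sub>R b | y b. y \<in> A \<and> b \<in> cball 0 1}" using y(1) by auto
qed

lemma lipschitz_like_iff_dist:
  fixes F :: "'m::metric_space \<Rightarrow> 'y::real_normed_vector set"
  shows "lipschitz_like F m0 y0 \<longleftrightarrow> y0 \<in> F m0 \<and>
    (\<exists>l>0. \<exists>\<delta>>0. \<forall>m m' y. dist m m0 < \<delta> \<longrightarrow> dist m' m0 < \<delta> \<longrightarrow> dist y y0 < \<delta> \<longrightarrow> y \<in> F m \<longrightarrow>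
       (\<exists>y'\<in>F m'. dist y y' \<le> l * dist m m'))" (is "?L \<longleftrightarrow> ?R")
proof
  assume ?L
  then obtain l U V where l: "y0 \<in> F m0" "l > 0" "m0 \<in> interior U" "y0 \<in> interior V"
    and F: "\<And>m m'. m \<in> U \<Longrightarrow> m' \<in> U \<Longrightarrow>
       F m \<inter> V \<subseteq> {y + (l * dist m m') *\<^sub>R b | y b. y \<in> F m' \<and> b \<in> cball 0 1}"
    unfolding lipschitz_like_def graph_of_def by auto
  obtain d e where d: "d > 0" "ball m0 d \<subseteq> U" and e: "e > 0" "ball y0 e \<subseteq> V"
    using l(3,4) by (auto simp: mem_interior)
  have "\<exists>y'\<in>F m'. dist y y' \<le> l * dist m m'"
    if "dist m m0 < min d e" "dist m' m0 < min d e" "dist y y0 < min d e" "y \<in> F m" for m m' y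
  proof -
    have "m \<in> U" "m' \<in> U" "y \<in> V" using that d(2) e(2) by (auto simp: dist_commute subset_iff)
    with F that(4) have "y \<in> {y + (l * dist m m') *\<^sub>R b | y b. y \<in> F m' \<and> b \<in> cball 0 1}" by blast
    then show ?thesis using l(2) by (subst (asm) mem_thickening_iff) auto
  qed
  then show ?R using l d(1) e(1) by (intro conjI exI[of _ l] exI[of _ "min d e"]) auto
next
  assume ?R
  then obtain l \<delta> where l: "y0 \<in> F m0" "l > 0" "\<delta> > 0" and
    F: "\<And>m m' y. dist m m0 < \<delta> \<Longrightarrow> dist m' m0 < \<delta> \<Longrightarrow> dist y y0 < \<delta> \<Longrightarrow> y \<in> F m \<Longrightarrow>
       \<exists>y'\<in>F m'. dist y y' \<le> l * dist m m'" by blast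
  have "F m \<inter> ball y0 \<delta> \<subseteq> {y + (l * dist m m') *\<^sub>R b | y b. y \<in> F m' \<and> b \<in> cball 0 1}"
    if "m \<in> ball m0 \<delta>" "m' \<in> ball m0 \<delta>" for m m'
  proof
    fix y assume "y \<in> F m \<inter> ball y0 \<delta>"
    then show "y \<in> {y + (l * dist m m') *\<^sub>R b | y b. y \<in> F m' \<and> b \<in> cball 0 1}"
      using F[of m m' y] that l(2) by (subst mem_thickening_iff) (auto simp: dist_commute)
  qed
  then show ?L unfolding lipschitz_like_def graph_of_def using l
    by (intro conjI exI[of _ l] exI[of _ "ball m0 \<delta>"] exI[of _ "ball y0 \<delta>"])
       (auto simp: interior_open)
qed

text \<open>
  The error \<open>C |x - u|\<^sup>2\<close> is of smaller order than \<open>|x - u|\<close>. Bounding \<open>\<phi> x\<close> through the reals \<open>\<beta>\<close> above it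
  keeps the hypothesis free of extended real arithmetic and makes it void where \<open>\<phi> x = \<infinity>\<close>.
\<close>

lemma proximal_imp_frechet_subdiff:
  fixes \<phi> :: "'x::real_inner \<Rightarrow> ereal"
  assumes fin: "\<bar>\<phi> u\<bar> \<noteq> \<infinity>" and \<rho>: "\<rho> > 0"
    and prox: "\<And>x \<beta>. dist x u < \<rho> \<Longrightarrow> \<phi> x \<le> ereal \<beta> \<Longrightarrow>
      real_of_ereal (\<phi> u) + inner v (x - u) - C * (norm (x - u))\<^sup>2 \<le> \<beta>"
  shows "v \<in> frechet_subdiff \<phi> u"
proof -
  define a where "a = real_of_ereal (\<phi> u)"
  have a: "\<phi> u = ereal a" using fin by (simp add: a_def ereal_real)
  have "0 \<le> Liminf (at u) (\<lambda>x. (\<phi> x - \<phi> u - ereal (inner v (x - u))) / ereal (norm (x - u)))"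
    unfolding le_Liminf_iff
  proof safe
    fix y :: ereal assume "y < 0"
    then obtain c :: real where c: "y < ereal c" "c < 0"
      by (metis ereal_dense2 ereal_less(4) less_ereal.simps(1) zero_ereal_def)
    define K where "K = \<bar>C\<bar> + 1"
    have K: "K > 0" "C \<le> K" by (auto simp: K_def)
    define \<rho>' where "\<rho>' = min \<rho> ((- c) / K)"
    have \<rho>': "\<rho>' > 0" using \<rho> c(2) K(1) divide_pos_pos[of "- c" K] by (simp add: \<rho>'_def)
    have "y < (\<phi> x - \<phi> u - ereal (inner v (x - u))) / ereal (norm (x - u))"
      if "x \<noteq> u" "dist x u < \<rho>'" for x
    proof (cases "\<phi> x")
      case (real \<beta>)
      define t where "t = norm (x - u)"
      have t: "t > 0" using that by (simp add: t_def)
      have "t < (- c) / K"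
        using that(2) by (simp add: \<rho>'_def t_def dist_norm)
      then have "t * K < - c"
        using K(1) by (subst (asm) pos_less_divide_eq) auto
      moreover have "C * t \<le> t * K"
        using mult_right_mono[OF K(2), of t] t by (simp add: mult.commute)
      ultimately have "c < - (C * t)" by linarith
      then have "c * t < - (C * t) * t" using t by (rule mult_strict_right_mono)
      also have "\<dots> \<le> \<beta> - a - inner v (x - u)"
        using prox[of x \<beta>] that(2) real by (simp add: \<rho>'_def a_def t_def power2_eq_square)
      finally have "c < (\<beta> - a - inner v (x - u)) / t" using t by (simp add: pos_less_divide_eq)
      then show ?thesis using c(1) t unfolding real a t_def[symmetric]
        by (simp add: less_trans)
    next
      case PInf
      then show ?thesis using that c(1) a by (auto simp: less_ereal.simps)
    next
      case MInf
      then show ?thesis using prox[of x "a + inner v (x - u) - C * (norm (x - u))\<^sup>2 - 1"] that(2)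
        by (simp add: \<rho>'_def a_def)
    qed
    then show "\<forall>\<^sub>F x in at u. y < (\<phi> x - \<phi> u - ereal (inner v (x - u))) / ereal (norm (x - u))"
      unfolding eventually_at using \<rho>' by blast
  qed
  then show ?thesis using fin by (simp add: frechet_subdiff_def)
qed

lemma frechet_subset_limiting_subdiff: "frechet_subdiff \<phi> u \<subseteq> limiting_subdiff \<phi> u"
proof
  fix v assume v: "v \<in> frechet_subdiff \<phi> u"
  then have "\<bar>\<phi> u\<bar> \<noteq> \<infinity>" by (simp add: frechet_subdiff_def)
  moreover have "(\<lambda>k::nat. u) \<longlonglongrightarrow> u \<and> (\<lambda>k::nat. \<phi> u) \<longlonglongrightarrow> \<phi> u \<and>
      (\<forall>k::nat. v \<in> frechet_subdiff \<phi> u) \<and> weakly_converges (\<lambda>k. v) v"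
    using v by (simp add: weakly_converges_def)
  ultimately show "v \<in> limiting_subdiff \<phi> u"
    unfolding limiting_subdiff_def
    by (intro CollectI conjI exI[of _ "\<lambda>_. u"] exI[of _ "\<lambda>_. v"]) blast+
qed

lemma partial_subdiff_finite: "v \<in> partial_subdiff g u p \<Longrightarrow> \<bar>g (u, p)\<bar> \<noteq> \<infinity>"
  by (simp add: partial_subdiff_def limiting_subdiff_def)

lemma lower_semicontinuous_imp_closed_epigraph:
  fixes g :: "'x::metric_space \<times> 'p::metric_space \<Rightarrow> ereal"
  assumes "lower_semicontinuous g"
  shows "closed (ereal_epigraph (\<lambda>x. g (x, p)))"
  unfolding closed_sequential_limits
proof (intro allI impI, elim conjE)
  fix s l assume s: "\<forall>n. s n \<in> ereal_epigraph (\<lambda>x. g (x, p))" and l: "s \<longlonglongrightarrow> l"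
  define x \<alpha> where "x = fst l" and "\<alpha> = snd l"
  have lim: "(\<lambda>n. fst (s n)) \<longlonglongrightarrow> x" "(\<lambda>n. snd (s n)) \<longlonglongrightarrow> \<alpha>"
    using l by (auto simp: x_def \<alpha>_def intro: tendsto_fst tendsto_snd)
  have "g (x, p) \<le> ereal \<alpha>"
  proof (rule ccontr)
    assume "\<not> g (x, p) \<le> ereal \<alpha>"
    then obtain c where c: "ereal \<alpha> < c" "c < g (x, p)" using dense[of "ereal \<alpha>" "g (x, p)"] by (auto simp: not_le)
    have "eventually (\<lambda>z. c < g z) (at (x, p))"
      using assms c(2) unfolding lower_semicontinuous_def le_Liminf_iff by blast
    then have "eventually (\<lambda>z. c < g z) (nhds (x, p))"
      using c(2) by (simp add: eventually_nhds_conv_at)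
    moreover have "(\<lambda>n. (fst (s n), p)) \<longlonglongrightarrow> (x, p)" by (intro tendsto_intros lim)
    ultimately have 1: "eventually (\<lambda>n. c < g (fst (s n), p)) sequentially"
      by (rule eventually_compose_filterlim)
    have "(\<lambda>n. ereal (snd (s n))) \<longlonglongrightarrow> ereal \<alpha>" using lim(2) by simp
    then have 2: "eventually (\<lambda>n. ereal (snd (s n)) < c) sequentially"
      using c(1) by (rule order_tendstoD)
    have "eventually (\<lambda>n. False) sequentially" using 1 2
    proof eventually_elim
      case (elim n)
      have "g (fst (s n), p) \<le> ereal (snd (s n))"
        using s by (auto simp: ereal_epigraph_def split: prod.splits dest!: spec[of _ n])
      with elim show ?case by auto
    qed
    then show False by simp
  qed
  then show "l \<in> ereal_epigraph (\<lambda>x. g (x, p))"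
    by (simp add: ereal_epigraph_def x_def \<alpha>_def case_prod_beta)
qed

section \<open>Prox-regularity on a uniform neighborhood\<close>

text \<open>
  The inequality of prox-regularity on balls of one common radius. The role of the bound
  \<open>g (u, p) \<le> g (xbar, pbar) + \<epsilon>\<close> is taken over by the closeness of \<open>(u, p, v)\<close> to the base point, from
  which it follows when \<open>g\<close> is continuous relative to the graph.
  As before, \<open>g (x, p)\<close> enters through the reals above it.
\<close>

definition uniform_prox_ineq ::
    "('x::real_inner \<times> 'p::metric_space \<Rightarrow> ereal) \<Rightarrow> 'x \<Rightarrow> 'p \<Rightarrow> 'x \<Rightarrow> real \<Rightarrow> real \<Rightarrow> bool" where
  "uniform_prox_ineq g xbar pbar vhat r \<delta> \<longleftrightarrow>
     (\<forall>u p v x \<beta>. dist u xbar < \<delta> \<longrightarrow> dist p pbar < \<delta> \<longrightarrow> dist v vhat < \<delta> \<longrightarrow>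
        v \<in> partial_subdiff g u p \<longrightarrow> dist x xbar < \<delta> \<longrightarrow> g (x, p) \<le> ereal \<beta> \<longrightarrow>
        real_of_ereal (g (u, p)) + inner v (x - u) - r / 2 * (norm (x - u))\<^sup>2 \<le> \<beta>)"

lemma uniform_prox_ineq_exists:
  assumes v: "vhat \<in> partial_subdiff g xbar pbar"
    and reg: "prox_regular_with g xbar pbar vhat r"
    and cont: "param_cont_prox_regular g xbar pbar vhat"
  obtains \<delta> where "\<delta> > 0" "uniform_prox_ineq g xbar pbar vhat r \<delta>"
proof -
  from reg obtain U V P \<epsilon> where \<epsilon>: "\<epsilon> > 0"
    and nb: "xbar \<in> interior U" "vhat \<in> interior V" "pbar \<in> interior P"
    and ineq: "\<And>u p v x. u \<in> U \<Longrightarrow> p \<in> P \<Longrightarrow> v \<in> partial_subdiff g u p \<Longrightarrow> v \<in> V \<Longrightarrow>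
       g (u, p) \<le> g (xbar, pbar) + ereal \<epsilon> \<Longrightarrow> x \<in> U \<Longrightarrow>
       g (x, p) \<ge> g (u, p) + ereal (inner v (x - u)) - ereal (r / 2 * (norm (x - u))\<^sup>2)"
    unfolding prox_regular_with_def by blast
  define GS where "GS = {(x, p, v). v \<in> partial_subdiff g x p}"
  have fin: "\<bar>g (xbar, pbar)\<bar> \<noteq> \<infinity>" using partial_subdiff_finite[OF v] .
  have "((\<lambda>(x, p, v). g (x, p)) \<longlongrightarrow> g (xbar, pbar)) (at (xbar, pbar, vhat) within GS)"
    using cont by (simp add: param_cont_prox_regular_def continuous_within GS_def)
  moreover have less: "g (xbar, pbar) < g (xbar, pbar) + ereal \<epsilon>"
    using fin \<epsilon> by (cases "g (xbar, pbar)") auto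
  ultimately have "eventually (\<lambda>(x, p, v). g (x, p) < g (xbar, pbar) + ereal \<epsilon>)
      (at (xbar, pbar, vhat) within GS)"
    using order_tendstoD(2) unfolding case_prod_beta by blast
  then obtain d where d: "d > 0"
    "\<And>s. s \<in> GS \<Longrightarrow> s \<noteq> (xbar, pbar, vhat) \<Longrightarrow> dist s (xbar, pbar, vhat) < d \<Longrightarrow>
       g (fst s, fst (snd s)) < g (xbar, pbar) + ereal \<epsilon>"
    unfolding eventually_at case_prod_beta by blast
  obtain d1 d2 d3 where d': "d1 > 0" "ball xbar d1 \<subseteq> U" "d2 > 0" "ball vhat d2 \<subseteq> V"
      "d3 > 0" "ball pbar d3 \<subseteq> P"
    using nb by (auto simp: mem_interior)
  define \<delta> where "\<delta> = Min {d / 3, d1, d2, d3}"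
  have \<delta>: "\<delta> > 0" "\<delta> \<le> d / 3" "\<delta> \<le> d1" "\<delta> \<le> d2" "\<delta> \<le> d3"
    using d(1) d' by (auto simp: \<delta>_def)
  have "real_of_ereal (g (u, p)) + inner v (x - u) - r / 2 * (norm (x - u))\<^sup>2 \<le> \<beta>"
    if u: "dist u xbar < \<delta>" and p: "dist p pbar < \<delta>" and vd: "dist v vhat < \<delta>"
      and vs: "v \<in> partial_subdiff g u p" and x: "dist x xbar < \<delta>" and \<beta>: "g (x, p) \<le> ereal \<beta>"
    for u p v x \<beta>
  proof -
    have "dist (u, p, v) (xbar, pbar, vhat) \<le> dist u xbar + dist (p, v) (pbar, vhat)"
      by (rule dist_Pair_le)
    also have "dist (p, v) (pbar, vhat) \<le> dist p pbar + dist v vhat"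
      by (rule dist_Pair_le)
    finally have "dist (u, p, v) (xbar, pbar, vhat) < d" using u p vd \<delta> by linarith
    then have "g (u, p) \<le> g (xbar, pbar) + ereal \<epsilon>"
      using d(2)[of "(u, p, v)"] vs less by (cases "(u, p, v) = (xbar, pbar, vhat)") (auto simp: GS_def)
    moreover have "u \<in> U" "p \<in> P" "v \<in> V" "x \<in> U"
      using u p vd x \<delta> d' by (auto simp: subset_iff dist_commute)
    ultimately have "g (u, p) + ereal (inner v (x - u)) - ereal (r / 2 * (norm (x - u))\<^sup>2) \<le> ereal \<beta>"
      using ineq vs \<beta> order_trans by blast
    then show ?thesis using partial_subdiff_finite[OF vs] by (cases "g (u, p)") auto
  qed
  then show ?thesis using that[OF \<delta>(1)] unfolding uniform_prox_ineq_def by blast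
qed

lemma uniform_prox_ineqD:
  assumes "uniform_prox_ineq g xbar pbar vhat r \<delta>" "v \<in> partial_subdiff g u p"
    "dist u xbar < \<delta>" "dist p pbar < \<delta>" "dist v vhat < \<delta>" "dist x xbar < \<delta>" "g (x, p) \<le> ereal \<beta>"
  shows "real_of_ereal (g (u, p)) + inner v (x - u) - r / 2 * (norm (x - u))\<^sup>2 \<le> \<beta>"
  using assms unfolding uniform_prox_ineq_def by blast

text \<open>Each of the two points is tested in the inequality of the other one, and the results are added.\<close>

lemma partial_subdiff_hypomonotone:
  assumes pri: "uniform_prox_ineq g xbar pbar vhat r \<delta>" and p: "dist p pbar < \<delta>"
    and 1: "v1 \<in> partial_subdiff g u1 p" "dist u1 xbar < \<delta>" "dist v1 vhat < \<delta>"
    and 2: "v2 \<in> partial_subdiff g u2 p" "dist u2 xbar < \<delta>" "dist v2 vhat < \<delta>"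
  shows "- r * (norm (u1 - u2))\<^sup>2 \<le> inner (v1 - v2) (u1 - u2)"
proof -
  obtain a1 a2 where a: "g (u1, p) = ereal a1" "g (u2, p) = ereal a2"
    using partial_subdiff_finite[OF 1(1)] partial_subdiff_finite[OF 2(1)] by auto
  have "a1 + inner v1 (u2 - u1) - r / 2 * (norm (u2 - u1))\<^sup>2 \<le> a2"
    using uniform_prox_ineqD[OF pri 1(1,2) p 1(3) 2(2), of a2] a by simp
  moreover have "a2 + inner v2 (u1 - u2) - r / 2 * (norm (u1 - u2))\<^sup>2 \<le> a1"
    using uniform_prox_ineqD[OF pri 2(1,2) p 2(3) 1(2), of a1] a by simp
  ultimately show ?thesis
    by (simp add: norm_minus_commute[of u2 u1] inner_diff_left inner_diff_right)
qed

section \<open>Stability of values under changes of the parameter\<close>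

lemma epigraph_lipschitz_upper:
  fixes g :: "'x::real_inner \<times> 'p::metric_space \<Rightarrow> ereal"
  assumes lip: "lipschitz_like (\<lambda>p. ereal_epigraph (\<lambda>x. g (x, p))) pbar (xbar, c)"
    and \<eta>: "\<eta> > 0"
  obtains d where "d > 0"
    "\<And>p. dist p pbar < d \<Longrightarrow> \<exists>x. dist x xbar \<le> \<eta> \<and> g (x, p) \<le> ereal (c + \<eta>)"
proof -
  obtain l \<delta> where l: "l > 0" "\<delta> > 0" and mem: "(xbar, c) \<in> ereal_epigraph (\<lambda>x. g (x, pbar))"
    and E: "\<And>p p' y. dist p pbar < \<delta> \<Longrightarrow> dist p' pbar < \<delta> \<Longrightarrow> dist y (xbar, c) < \<delta> \<Longrightarrow>
      y \<in> ereal_epigraph (\<lambda>x. g (x, p)) \<Longrightarrow>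
      \<exists>y'\<in>ereal_epigraph (\<lambda>x. g (x, p')). dist y y' \<le> l * dist p p'"
    using lip unfolding lipschitz_like_iff_dist by blast
  show ?thesis
  proof (rule that[of "min \<delta> (\<eta> / l)"])
    fix p assume p: "dist p pbar < min \<delta> (\<eta> / l)"
    then have ld: "l * dist pbar p \<le> \<eta>"
      using l by (simp add: pos_less_divide_eq dist_commute mult.commute)
    obtain y where y: "y \<in> ereal_epigraph (\<lambda>x. g (x, p))" "dist (xbar, c) y \<le> l * dist pbar p"
      using E[of pbar p "(xbar, c)"] mem p l by auto
    have "dist xbar (fst y) \<le> \<eta>" "dist c (snd y) \<le> \<eta>"
      using dist_fst_le[of "(xbar, c)" y] dist_snd_le[of "(xbar, c)" y] y(2) ld by auto
    moreover have "g (fst y, p) \<le> ereal (snd y)" using y(1) by (auto simp: ereal_epigraph_def)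
    ultimately show "\<exists>x. dist x xbar \<le> \<eta> \<and> g (x, p) \<le> ereal (c + \<eta>)"
      by (intro exI[of _ "fst y"] conjI)
         (auto simp: dist_commute dist_real_def elim!: order_trans)
  qed (use l \<eta> in simp)
qed

text \<open>
  At the base parameter the bound is the prox-regularity inequality at \<open>xbar\<close>. A point \<open>(x, \<beta>)\<close> of the
  epigraph at \<open>p\<close> has a close companion in the epigraph at \<open>pbar\<close>, so the bound is transferred up to
  \<open>\<eta>\<close>. The Lipschitz-like property speaks only of \<open>\<beta>\<close> close to \<open>c\<close>. For larger \<open>\<beta>\<close> there is nothing
  to prove, as the bound itself stays near \<open>c\<close>. A much smaller \<open>\<beta>\<close> is impossible: the epigraph would
  then contain a point over \<open>x\<close> with a height in the admissible range but below the bound. The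
  radius \<open>\<sigma>\<close> does not depend on \<open>\<eta>\<close>, so that \<open>\<eta>\<close> can later be taken small compared with \<open>\<sigma>\<^sup>2\<close>.
\<close>

lemma epigraph_lipschitz_lower:
  fixes g :: "'x::real_inner \<times> 'p::metric_space \<Rightarrow> ereal"
  assumes pri: "uniform_prox_ineq g xbar pbar vhat r \<delta>" and \<delta>: "\<delta> > 0" and r: "r \<ge> 0"
    and vhat: "vhat \<in> partial_subdiff g xbar pbar"
    and c: "c = real_of_ereal (g (xbar, pbar))"
    and lip: "lipschitz_like (\<lambda>p. ereal_epigraph (\<lambda>x. g (x, p))) pbar (xbar, c)"
    and \<sigma>0: "\<sigma>0 > 0"
  obtains \<sigma> where "\<sigma> > 0" "\<sigma> \<le> \<sigma>0"
    "\<And>\<eta>. \<eta> > 0 \<Longrightarrow> \<exists>d>0. \<forall>p x \<beta>. dist p pbar < d \<longrightarrow> dist x xbar \<le> \<sigma> \<longrightarrow> g (x, p) \<le> ereal \<beta> \<longrightarrow>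
       c + inner vhat (x - xbar) - r / 2 * (norm (x - xbar))\<^sup>2 - \<eta> \<le> \<beta>"
proof -
  obtain l \<delta>1 where l: "l > 0" "\<delta>1 > 0"
    and E: "\<And>p p' y. dist p pbar < \<delta>1 \<Longrightarrow> dist p' pbar < \<delta>1 \<Longrightarrow> dist y (xbar, c) < \<delta>1 \<Longrightarrow>
      y \<in> ereal_epigraph (\<lambda>x. g (x, p)) \<Longrightarrow>
      \<exists>y'\<in>ereal_epigraph (\<lambda>x. g (x, p')). dist y y' \<le> l * dist p p'"
    using lip unfolding lipschitz_like_iff_dist by blast
  define q where "q x = inner vhat (x - xbar) - r / 2 * (norm (x - xbar))\<^sup>2" for x
  \<comment> \<open>On the ball of radius \<open>\<sigma> \<le> 1\<close>, \<open>|q|\<close> is at most \<open>\<sigma> N\<close>; moving a point of the epigraph by at most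
    \<open>s \<le> 1\<close> in each component costs at most \<open>s N\<close> in the bound.\<close>
  define N where "N = norm vhat + 2 * r + 1"
  have N: "N > 0" using r by (simp add: N_def add_nonneg_pos)
  define \<sigma> where "\<sigma> = Min {\<sigma>0, \<delta> / 2, 1, \<delta>1 / 2, \<delta>1 / 4 / N}"
  have \<sigma>: "\<sigma> > 0" "\<sigma> \<le> \<sigma>0" "\<sigma> \<le> \<delta> / 2" "\<sigma> \<le> 1" "\<sigma> \<le> \<delta>1 / 2" "\<sigma> \<le> \<delta>1 / 4 / N"
    using \<sigma>0 \<delta> l N by (auto simp: \<sigma>_def)
  have N\<sigma>: "\<sigma> * N \<le> \<delta>1 / 4" using \<sigma>(6) N by (simp add: pos_le_divide_eq)
  have q_small: "\<bar>q x\<bar> \<le> \<delta>1 / 4" if "dist x xbar \<le> \<sigma>" for x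
  proof -
    have n: "norm (x - xbar) \<le> \<sigma>" using that by (simp add: dist_norm)
    have "\<bar>inner vhat (x - xbar)\<bar> \<le> norm vhat * \<sigma>"
      using Cauchy_Schwarz_ineq2[of vhat "x - xbar"] mult_left_mono[OF n norm_ge_zero[of vhat]] by linarith
    moreover have "(norm (x - xbar))\<^sup>2 \<le> \<sigma> * 1"
      unfolding power2_eq_square using n \<sigma>(1,4) by (intro mult_mono) auto
    then have "r / 2 * (norm (x - xbar))\<^sup>2 \<le> r / 2 * \<sigma>" using r by (intro mult_left_mono) auto
    moreover have "0 \<le> r / 2 * (norm (x - xbar))\<^sup>2" using r by simp
    moreover have "0 \<le> r * \<sigma>" using r \<sigma>(1) by simp
    moreover have "\<sigma> * N = norm vhat * \<sigma> + 2 * (r * \<sigma>) + \<sigma>" by (simp add: N_def algebra_simps)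
    ultimately show ?thesis using N\<sigma> \<sigma>(1) unfolding q_def by linarith
  qed
  have "\<exists>d>0. \<forall>p x \<beta>. dist p pbar < d \<longrightarrow> dist x xbar \<le> \<sigma> \<longrightarrow> g (x, p) \<le> ereal \<beta> \<longrightarrow> c + q x - \<eta> \<le> \<beta>"
    if \<eta>: "\<eta> > 0" for \<eta>
  proof -
    define \<eta>' where "\<eta>' = min \<eta> (\<delta>1 / 16)"
    have \<eta>': "\<eta>' > 0" "\<eta>' \<le> \<eta>" "\<eta>' \<le> \<delta>1 / 16" using \<eta> l by (auto simp: \<eta>'_def)
    define s where "s = Min {\<delta> / 3, 1, \<eta>' / N}"
    have s: "s > 0" "s \<le> \<delta> / 3" "s \<le> 1" "s \<le> \<eta>' / N" using \<delta> \<eta>' N by (auto simp: s_def simp del: le_divide_eq_numeral1)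
    have sN: "s * N \<le> \<eta>'" using s(4) N by (simp add: pos_le_divide_eq)
    define d where "d = min \<delta>1 (s / l)"
    have d: "d > 0" "d \<le> \<delta>1" using l s by (auto simp: d_def)
    have near: "c + q x - \<eta>' \<le> \<beta>"
      if p: "dist p pbar < d" and x: "dist x xbar \<le> \<sigma>" and \<beta>: "g (x, p) \<le> ereal \<beta>"
        and near: "\<bar>\<beta> - c\<bar> < \<delta>1 / 2" for p x \<beta>
    proof -
      have "dist (x, \<beta>) (xbar, c) \<le> dist x xbar + dist \<beta> c"
        by (rule dist_Pair_le)
      also have "\<dots> < \<delta>1" using x near \<sigma>(5) by (simp add: dist_real_def)
      finally obtain y where y: "y \<in> ereal_epigraph (\<lambda>x. g (x, pbar))"
          "dist (x, \<beta>) y \<le> l * dist p pbar"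
        using E[of p pbar "(x, \<beta>)"] p d \<beta> l by (auto simp: ereal_epigraph_def)
      have "l * dist p pbar \<le> s" using p l by (simp add: d_def pos_less_divide_eq mult.commute)
      with y(2) dist_fst_le[of "(x, \<beta>)" y] dist_snd_le[of "(x, \<beta>)" y]
      have y': "dist x (fst y) \<le> s" "\<bar>\<beta> - snd y\<bar> \<le> s" by (auto simp: dist_real_def)
      define x' where "x' = fst y"
      have x': "norm (x' - x) \<le> s" using y'(1) by (simp add: x'_def dist_norm norm_minus_commute)
      have "dist x' xbar < \<delta>"
        using dist_triangle[of x' xbar x] x' x s(2) \<sigma>(3) \<delta> by (simp add: dist_norm)
      moreover have "g (x', pbar) \<le> ereal (snd y)"
        using y(1) by (auto simp: ereal_epigraph_def x'_def)
      ultimately have "c + q x' \<le> snd y"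
        using uniform_prox_ineqD[OF pri vhat, of x' "snd y"] \<delta> by (simp add: c q_def)
      moreover have "q x \<le> q x' + s * (norm vhat + 2 * r)"
      proof -
        have "inner vhat (x - x') \<le> norm vhat * norm (x - x')" by (rule norm_cauchy_schwarz)
        also have "\<dots> \<le> norm vhat * s"
          using x' by (intro mult_left_mono) (auto simp: norm_minus_commute)
        finally have 1: "inner vhat (x - xbar) \<le> inner vhat (x' - xbar) + norm vhat * s"
          by (simp add: inner_diff_right)
        have n: "norm (x - xbar) \<le> 1" using x \<sigma>(4) by (simp add: dist_norm)
        have "norm (x' - xbar) \<le> norm (x - xbar) + s"
          using norm_triangle_ineq[of "x' - x" "x - xbar"] x' by simp
        then have "(norm (x' - xbar))\<^sup>2 \<le> (norm (x - xbar) + s)\<^sup>2" by (simp add: power_mono)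
        also have "\<dots> = (norm (x - xbar))\<^sup>2 + 2 * s * norm (x - xbar) + s * s"
          by (simp add: power2_eq_square algebra_simps)
        also have "2 * s * norm (x - xbar) \<le> 2 * s * 1" using n s by (intro mult_left_mono) auto
        also have "s * s \<le> s * 1" using s by (intro mult_left_mono) auto
        finally have "r / 2 * (norm (x' - xbar))\<^sup>2 \<le> r / 2 * ((norm (x - xbar))\<^sup>2 + 4 * s)"
          using r s by (intro mult_left_mono) auto
        then show ?thesis using 1 by (simp add: q_def algebra_simps)
      qed
      moreover have "s * N = s * (norm vhat + 2 * r) + s" by (simp add: N_def algebra_simps)
      ultimately show ?thesis using sN y'(2) by linarith
    qed
    have "c + q x - \<eta> \<le> \<beta>"
      if p: "dist p pbar < d" and x: "dist x xbar \<le> \<sigma>" and \<beta>: "g (x, p) \<le> ereal \<beta>" for p x \<beta>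
    proof -
      consider "\<beta> \<le> c - \<delta>1 / 2" | "\<bar>\<beta> - c\<bar> < \<delta>1 / 2" | "\<beta> \<ge> c + \<delta>1 / 2" by linarith
      then show ?thesis
      proof cases
        \<comment> \<open>The height \<open>c - 3/8 \<delta>1\<close> is less than \<open>\<delta>1 / 2\<close> away from \<open>c\<close>, but lies below
          \<open>c - \<delta>1 / 4 - \<delta>1 / 16\<close>, so the bound with tolerance \<open>\<eta>'\<close> fails there.\<close>
        case 1
        then have "g (x, p) \<le> ereal (c - 3 / 8 * \<delta>1)" using l by (intro order_trans[OF \<beta>]) simp
        from near[OF p x this] q_small[OF x] l \<eta>' show ?thesis by linarith
      next
        case 2
        then show ?thesis using near[OF p x \<beta>] \<eta>' by linarith
      next
        case 3
        then show ?thesis using q_small[OF x] l \<eta> by linarith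
      qed
    qed
    then show ?thesis using d(1) by blast
  qed
  then show ?thesis using that[of \<sigma>] \<sigma>(1,2) by (simp add: q_def algebra_simps)
qed

section \<open>Existence of resolvent points\<close>

text \<open>
  With \<open>\<tau> = 1 / lam\<close> and \<open>u = (v - xbar) / lam\<close>, the inclusion \<open>v \<in> x + lam \<partial>\<^sub>x g(x, p)\<close> reads
  \<open>u \<in> \<partial>\<^sub>x g(x, p) + \<tau> (x - xbar)\<close>, and its solutions are sought as minimizers of
  \<open>k x = g(x, p) - \<langle>u, x - xbar\<rangle> + \<tau>/2 |x - xbar|\<^sup>2\<close> on the ball of radius \<open>\<sigma>\<close>. Since \<open>r < \<tau>\<close>, the lower
  bound on the values makes \<open>k\<close> grow like \<open>\<kappa> |x - xbar|\<^sup>2\<close>, up to an error that is a fraction of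
  \<open>\<gamma> = \<kappa> \<sigma>\<^sup>2\<close>; this keeps the point \<open>z\<close> of the variational principle away from the
  boundary, where the constraint to the ball would otherwise enter the subgradient.
\<close>

lemma approximate_resolvent_points:
  fixes g :: "'x::{real_inner, complete_space} \<times> 'p::metric_space \<Rightarrow> ereal"
  assumes g_not_minf: "\<And>z. g z \<noteq> -\<infinity>" and lsc: "lower_semicontinuous g"
    and pri: "uniform_prox_ineq g xbar pbar vhat r \<delta>" and \<delta>: "\<delta> > 0" and r: "r \<ge> 0"
    and vhat: "vhat \<in> partial_subdiff g xbar pbar"
    and lip: "lipschitz_like (\<lambda>p. ereal_epigraph (\<lambda>x. g (x, p))) pbar
      (xbar, real_of_ereal (g (xbar, pbar)))"
    and \<tau>: "\<tau> > 0" "r < \<tau>" and \<rho>: "\<rho> > 0"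
  shows "\<exists>d>0. \<forall>u p. norm (u - vhat) < d \<longrightarrow> dist p pbar < d \<longrightarrow>
    (\<forall>\<epsilon>>0. \<exists>z w. dist z xbar < \<rho> \<and> w \<in> partial_subdiff g z p \<and>
       norm (w + \<tau> *\<^sub>R (z - xbar) - u) \<le> \<epsilon>)"
proof -
  define c where "c = real_of_ereal (g (xbar, pbar))"
  have "min \<rho> 1 > 0" using \<rho> by simp
  from epigraph_lipschitz_lower[OF pri \<delta> r vhat c_def lip[folded c_def] this]
  obtain \<sigma> where \<sigma>': "\<sigma> > 0" "\<sigma> \<le> min \<rho> 1" and lower:
    "\<And>\<eta>. \<eta> > 0 \<Longrightarrow> \<exists>d>0. \<forall>p x \<beta>. dist p pbar < d \<longrightarrow> dist x xbar \<le> \<sigma> \<longrightarrow> g (x, p) \<le> ereal \<beta> \<longrightarrow>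
       c + inner vhat (x - xbar) - r / 2 * (norm (x - xbar))\<^sup>2 - \<eta> \<le> \<beta>"
    by blast
  have \<sigma>: "\<sigma> > 0" "\<sigma> \<le> \<rho>" "\<sigma> \<le> 1" using \<sigma>' by auto
  define \<kappa> where "\<kappa> = (\<tau> - r) / 2"
  have \<kappa>: "\<kappa> > 0" using \<tau> by (simp add: \<kappa>_def)
  define \<gamma> where "\<gamma> = \<kappa> * \<sigma>\<^sup>2"
  have \<gamma>: "\<gamma> > 0" using \<kappa> \<sigma> by (simp add: \<gamma>_def)
  obtain d1 where d1: "d1 > 0" and low:
    "\<And>p x \<beta>. dist p pbar < d1 \<Longrightarrow> dist x xbar \<le> \<sigma> \<Longrightarrow> g (x, p) \<le> ereal \<beta> \<Longrightarrow>
       c + inner vhat (x - xbar) - r / 2 * (norm (x - xbar))\<^sup>2 - \<gamma> / 8 \<le> \<beta>"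
    using lower[of "\<gamma> / 8"] \<gamma> by auto
  \<comment> \<open>The increase of \<open>k\<close> from \<open>c\<close> to its value at a point \<open>x0\<close> as in \<open>epigraph_lipschitz_upper\<close> is at
    most \<open>\<eta> N\<close>.\<close>
  define N where "N = norm vhat + 2 + \<tau>"
  have N: "N > 0" using \<tau> by (simp add: N_def add_nonneg_pos)
  define \<eta> where "\<eta> = Min {\<sigma>, 1, \<gamma> / 8 / N}"
  have \<eta>: "\<eta> > 0" "\<eta> \<le> \<sigma>" "\<eta> \<le> 1" "\<eta> \<le> \<gamma> / 8 / N" using \<sigma> \<gamma> N by (auto simp: \<eta>_def)
  have \<eta>N: "\<eta> * N \<le> \<gamma> / 8" using \<eta>(4) N by (simp add: pos_le_divide_eq)
  obtain d2 where d2: "d2 > 0" and up: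
    "\<And>p. dist p pbar < d2 \<Longrightarrow> \<exists>x. dist x xbar \<le> \<eta> \<and> g (x, p) \<le> ereal (c + \<eta>)"
    using epigraph_lipschitz_upper[OF lip[folded c_def] \<eta>(1)] by blast
  define d where "d = Min {d1, d2, \<gamma> / 8, 1}"
  have d: "d > 0" "d \<le> d1" "d \<le> d2" "d \<le> \<gamma> / 8" "d \<le> 1" using d1 d2 \<gamma> by (auto simp: d_def)
  have "\<exists>z w. dist z xbar < \<rho> \<and> w \<in> partial_subdiff g z p \<and>
       norm (w + \<tau> *\<^sub>R (z - xbar) - u) \<le> \<epsilon>"
    if u: "norm (u - vhat) < d" and p: "dist p pbar < d" and \<epsilon>: "\<epsilon> > 0" for u p \<epsilon>
  proof -
    define D where "D = {x. dist x xbar \<le> \<sigma> \<and> g (x, p) \<noteq> \<infinity>}"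
    define \<phi> where "\<phi> x = real_of_ereal (g (x, p))" for x
    have g_eq: "g (x, p) = ereal (\<phi> x)" if "x \<in> D" for x
      using that g_not_minf[of "(x, p)"] by (cases "g (x, p)") (auto simp: D_def \<phi>_def)
    define k where "k x = \<phi> x - inner u (x - xbar) + \<tau> / 2 * (norm (x - xbar))\<^sup>2" for x
    have inner_u: "\<bar>inner (vhat - u) (x - xbar)\<bar> \<le> \<gamma> / 8" if "dist x xbar \<le> \<sigma>" for x
    proof -
      have "\<bar>inner (vhat - u) (x - xbar)\<bar> \<le> norm (vhat - u) * norm (x - xbar)"
        by (rule Cauchy_Schwarz_ineq2)
      also have "\<dots> \<le> d * 1"
        using u that \<sigma> d by (intro mult_mono) (auto simp: dist_norm norm_minus_commute)
      finally show ?thesis using d(4) by simp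
    qed
    have k_low: "c + \<kappa> * (norm (x - xbar))\<^sup>2 - \<gamma> / 4 \<le> k x" if "x \<in> D" for x
    proof -
      have xs: "dist x xbar \<le> \<sigma>" using that by (simp add: D_def)
      have "c + inner vhat (x - xbar) - r / 2 * (norm (x - xbar))\<^sup>2 - \<gamma> / 8 \<le> \<phi> x"
        using low[of p x "\<phi> x"] p d xs g_eq[OF that] by simp
      moreover have "inner (vhat - u) (x - xbar) = inner vhat (x - xbar) - inner u (x - xbar)"
        by (rule inner_diff_left)
      moreover have "\<kappa> * (norm (x - xbar))\<^sup>2 =
          \<tau> / 2 * (norm (x - xbar))\<^sup>2 - r / 2 * (norm (x - xbar))\<^sup>2"
        by (simp add: \<kappa>_def left_diff_distrib diff_divide_distrib)
      ultimately show ?thesis using inner_u[OF xs] unfolding k_def by linarith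
    qed
    obtain x0 where x0: "dist x0 xbar \<le> \<eta>" "g (x0, p) \<le> ereal (c + \<eta>)" using up p d by force
    have x0D: "x0 \<in> D" using x0 \<eta> by (auto simp: D_def)
    have k_x0: "k x0 \<le> c + \<gamma> / 8"
    proof -
      have n: "norm (x0 - xbar) \<le> \<eta>" using x0 by (simp add: dist_norm)
      have "- inner u (x0 - xbar) \<le> norm u * norm (x0 - xbar)"
        using Cauchy_Schwarz_ineq2[of u "x0 - xbar"] by linarith
      also have "\<dots> \<le> (norm vhat + 1) * \<eta>"
        using n u d(5) norm_triangle_sub[of u vhat] by (intro mult_mono) auto
      finally have 1: "- inner u (x0 - xbar) \<le> (norm vhat + 1) * \<eta>" .
      have "(norm (x0 - xbar))\<^sup>2 \<le> \<eta> * 1"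
        unfolding power2_eq_square using n \<eta> by (intro mult_mono) auto
      then have "\<tau> / 2 * (norm (x0 - xbar))\<^sup>2 \<le> \<tau> / 2 * \<eta>" using \<tau> by (intro mult_left_mono) auto
      moreover have "\<tau> / 2 * \<eta> \<le> \<tau> * \<eta>" using \<tau> \<eta> by simp
      moreover have "\<phi> x0 \<le> c + \<eta>" using x0 g_eq[OF x0D] by simp
      moreover have "\<eta> * N = (norm vhat + 1) * \<eta> + \<eta> + \<tau> * \<eta>" by (simp add: N_def algebra_simps)
      ultimately show ?thesis using 1 \<eta>N unfolding k_def by linarith
    qed
    define \<epsilon>' where "\<epsilon>' = min \<epsilon> (\<gamma> / 48)"
    have \<epsilon>': "\<epsilon>' > 0" "\<epsilon>' \<le> \<epsilon>" "\<epsilon>' \<le> \<gamma> / 48" using \<epsilon> \<gamma> by (auto simp: \<epsilon>'_def)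
    have "D \<subseteq> cball xbar \<sigma>" by (auto simp: D_def dist_commute)
    then have bdd: "bounded D" using bounded_cball bounded_subset by blast
    \<comment> \<open>Adding a continuous function shears the closed epigraph of \<open>g(\<cdot>, p)\<close>.\<close>
    have epi: "closed {(x, \<alpha>). x \<in> D \<and> k x \<le> \<alpha>}"
    proof -
      let ?h = "\<lambda>y. (fst y, snd y + inner u (fst y - xbar) - \<tau> / 2 * (norm (fst y - xbar))\<^sup>2)"
      have "{(x, \<alpha>). x \<in> D \<and> k x \<le> \<alpha>} =
          ?h -` ereal_epigraph (\<lambda>x. g (x, p)) \<inter> fst -` cball xbar \<sigma>"
      proof (intro set_eqI)
        fix y :: "'x \<times> real"
        show "y \<in> {(x, \<alpha>). x \<in> D \<and> k x \<le> \<alpha>} \<longleftrightarrow>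
            y \<in> ?h -` ereal_epigraph (\<lambda>x. g (x, p)) \<inter> fst -` cball xbar \<sigma>"
        proof (cases "fst y \<in> D")
          case True
          then show ?thesis using g_eq[OF True]
            by (auto simp: ereal_epigraph_def k_def D_def case_prod_beta dist_commute)
        next
          case False
          then show ?thesis
            by (auto simp: ereal_epigraph_def D_def case_prod_beta dist_commute)
        qed
      qed
      moreover have "closed (?h -` ereal_epigraph (\<lambda>x. g (x, p)))"
        by (intro closed_vimage lower_semicontinuous_imp_closed_epigraph lsc continuous_intros)
      moreover have "closed (fst -` cball xbar \<sigma> :: ('x \<times> real) set)"
        by (intro closed_vimage closed_cball continuous_intros)
      ultimately show ?thesis by auto
    qed
    have "c - \<gamma> / 4 \<le> k x" if "x \<in> D" for x
    proof -
      have "0 \<le> \<kappa> * (norm (x - xbar))\<^sup>2" using \<kappa> by simp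
      then show ?thesis using k_low[OF that] by linarith
    qed
    from quadratic_variational_principle[OF _ bdd epi this \<epsilon>'(1)] x0D
    obtain z w' where z: "z \<in> D" and w': "norm w' \<le> \<epsilon>'"
      and min: "\<And>x. x \<in> D \<Longrightarrow> k z + inner w' (x - z) - \<epsilon>' * (norm (x - z))\<^sup>2 \<le> k x"
      by blast
    have "\<kappa> * (norm (z - xbar))\<^sup>2 < \<kappa> * \<sigma>\<^sup>2"
    proof -
      have "dist x0 z \<le> dist x0 xbar + dist z xbar" by (rule dist_triangle2)
      then have n: "norm (x0 - z) \<le> 2" using x0 \<eta> z \<sigma>(3) by (simp add: D_def dist_norm)
      have "\<bar>inner w' (x0 - z)\<bar> \<le> norm w' * norm (x0 - z)" by (rule Cauchy_Schwarz_ineq2)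
      also have "\<dots> \<le> \<epsilon>' * 2" using w' n \<epsilon>' by (intro mult_mono) auto
      finally have "- inner w' (x0 - z) \<le> \<epsilon>' * 2" by linarith
      moreover have "(norm (x0 - z))\<^sup>2 \<le> 2\<^sup>2" using n by (intro power_mono) auto
      then have "\<epsilon>' * (norm (x0 - z))\<^sup>2 \<le> \<epsilon>' * 4" using \<epsilon>' by (intro mult_left_mono) auto
      ultimately have "k z \<le> k x0 + 6 * \<epsilon>'" using min[OF x0D] by linarith
      then show ?thesis using k_low[OF z] k_x0 \<epsilon>'(3) \<gamma> unfolding \<gamma>_def[symmetric] by linarith
    qed
    then have "(norm (z - xbar))\<^sup>2 < \<sigma>\<^sup>2" using \<kappa> by simp
    then have z_int: "dist z xbar < \<sigma>"
      unfolding dist_norm by (rule power2_less_imp_less) (use \<sigma>(1) in simp)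
    define w where "w = w' + u - \<tau> *\<^sub>R (z - xbar)"
    have "w \<in> frechet_subdiff (\<lambda>x. g (x, p)) z"
    proof (rule proximal_imp_frechet_subdiff)
      show "\<bar>g (z, p)\<bar> \<noteq> \<infinity>" using g_eq[OF z] by simp
      show "\<sigma> - dist z xbar > 0" using z_int by simp
      fix x \<beta> assume x: "dist x z < \<sigma> - dist z xbar" "g (x, p) \<le> ereal \<beta>"
      have xD: "x \<in> D" using x dist_triangle[of x xbar z] by (auto simp: D_def)
      have "\<phi> x \<le> \<beta>" using x(2) g_eq[OF xD] by simp
      moreover have "(norm (x - xbar))\<^sup>2 = (norm (z - xbar))\<^sup>2 + 2 * inner (z - xbar) (x - z) + (norm (x - z))\<^sup>2"
        by (simp add: power2_norm_eq_inner algebra_simps inner_commute)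
      then have "\<tau> / 2 * (norm (x - xbar))\<^sup>2 = \<tau> / 2 * (norm (z - xbar))\<^sup>2
          + \<tau> * inner (z - xbar) (x - z) + \<tau> / 2 * (norm (x - z))\<^sup>2"
        by (simp add: distrib_left)
      moreover have "inner u (x - xbar) = inner u (z - xbar) + inner u (x - z)"
        by (simp add: inner_diff_right)
      moreover have "inner w (x - z) = inner w' (x - z) + inner u (x - z) - \<tau> * inner (z - xbar) (x - z)"
        by (simp add: w_def inner_add_left inner_diff_left)
      moreover have "(\<epsilon>' + \<tau> / 2) * (norm (x - z))\<^sup>2 = \<epsilon>' * (norm (x - z))\<^sup>2 + \<tau> / 2 * (norm (x - z))\<^sup>2"
        by (rule distrib_right)
      ultimately show "real_of_ereal (g (z, p)) + inner w (x - z) - (\<epsilon>' + \<tau> / 2) * (norm (x - z))\<^sup>2 \<le> \<beta>"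
        using min[OF xD] unfolding k_def \<phi>_def[symmetric] by linarith
    qed
    then have "w \<in> partial_subdiff g z p"
      using frechet_subset_limiting_subdiff by (auto simp: partial_subdiff_def)
    moreover have "norm (w + \<tau> *\<^sub>R (z - xbar) - u) \<le> \<epsilon>" using w' \<epsilon>' by (simp add: w_def)
    ultimately show ?thesis using z_int \<sigma>(2) by (intro exI[of _ z] exI[of _ w]) simp
  qed
  then show ?thesis using d(1) by blast
qed

text \<open>
  The approximate solutions \<open>z n\<close> for residuals tending to zero form a Cauchy sequence, because
  \<open>\<partial>\<^sub>x g(\<cdot>, p) + \<tau> I\<close> is strongly monotone with constant \<open>\<tau> - r\<close> where they live. Their subgradients then
  converge in norm, and the limit is a proximal subgradient: passing to the limit directly in the
  prox-regularity inequality avoids having to show that the values \<open>g(z n, p)\<close> converge.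
\<close>

lemma resolvent_points_exist:
  fixes g :: "'x::{real_inner, complete_space} \<times> 'p::metric_space \<Rightarrow> ereal"
  assumes g_not_minf: "\<And>z. g z \<noteq> -\<infinity>" and lsc: "lower_semicontinuous g"
    and pri: "uniform_prox_ineq g xbar pbar vhat r \<delta>" and \<delta>: "\<delta> > 0" and r: "r \<ge> 0"
    and vhat: "vhat \<in> partial_subdiff g xbar pbar"
    and lip: "lipschitz_like (\<lambda>p. ereal_epigraph (\<lambda>x. g (x, p))) pbar
      (xbar, real_of_ereal (g (xbar, pbar)))"
    and \<tau>: "\<tau> > 0" "r < \<tau>" and \<rho>: "\<rho> > 0"
  shows "\<exists>d>0. \<forall>u p. norm (u - vhat) < d \<longrightarrow> dist p pbar < d \<longrightarrow>
    (\<exists>x. dist x xbar < \<rho> \<and> u - \<tau> *\<^sub>R (x - xbar) \<in> partial_subdiff g x p)"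
proof -
  \<comment> \<open>The residual, \<open>u - vhat\<close> and \<open>\<tau> *\<^sub>R (z - xbar)\<close> each contribute at most \<open>\<delta> / 4\<close> to \<open>w - vhat\<close>.\<close>
  define \<rho>' where "\<rho>' = Min {\<rho> / 2, \<delta> / 2, \<delta> / 4 / \<tau>}"
  have \<rho>': "\<rho>' > 0" "\<rho>' \<le> \<rho> / 2" "\<rho>' \<le> \<delta> / 2" "\<rho>' \<le> \<delta> / 4 / \<tau>"
    using \<rho> \<delta> \<tau> by (auto simp: \<rho>'_def)
  have \<tau>\<rho>: "\<tau> * \<rho>' \<le> \<delta> / 4" using \<rho>'(4) \<tau> by (simp add: pos_le_divide_eq mult.commute)
  obtain d1 where d1: "d1 > 0" and approx:
    "\<And>u p \<epsilon>. norm (u - vhat) < d1 \<Longrightarrow> dist p pbar < d1 \<Longrightarrow> \<epsilon> > 0 \<Longrightarrow>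
      \<exists>z w. dist z xbar < \<rho>' \<and> w \<in> partial_subdiff g z p \<and> norm (w + \<tau> *\<^sub>R (z - xbar) - u) \<le> \<epsilon>"
    using approximate_resolvent_points[OF g_not_minf lsc pri \<delta> r vhat lip \<tau> \<rho>'(1)] by blast
  define d where "d = min d1 (\<delta> / 4)"
  have d: "d > 0" "d \<le> d1" "d \<le> \<delta> / 4" using d1 \<delta> by (auto simp: d_def)
  have "\<exists>x. dist x xbar < \<rho> \<and> u - \<tau> *\<^sub>R (x - xbar) \<in> partial_subdiff g x p"
    if u: "norm (u - vhat) < d" and p: "dist p pbar < d" for u p
  proof -
    define e where "e n = \<delta> / 4 * inverse (real (Suc n))" for n
    have e: "e n > 0" "e n \<le> \<delta> / 4" for n
    proof -
      show "e n > 0" using \<delta> by (simp add: e_def)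
      have "inverse (real (Suc n)) \<le> 1" by (rule inverse_le_1_iff[THEN iffD2]) simp
      then show "e n \<le> \<delta> / 4" unfolding e_def using \<delta> mult_left_mono[of _ 1 "\<delta> / 4"] by simp
    qed
    have "(\<lambda>n. \<delta> / 4 * inverse (real (Suc n))) \<longlonglongrightarrow> \<delta> / 4 * 0"
      by (intro tendsto_intros LIMSEQ_inverse_real_of_nat)
    then have e_lim: "e \<longlonglongrightarrow> 0" by (simp add: e_def[abs_def])
    have "\<forall>n. \<exists>z w. dist z xbar < \<rho>' \<and> w \<in> partial_subdiff g z p \<and>
        norm (w + \<tau> *\<^sub>R (z - xbar) - u) \<le> e n"
      using approx[of u p] u p d e by simp
    then obtain z w where z: "\<And>n. dist (z n) xbar < \<rho>'"
      and w: "\<And>n. w n \<in> partial_subdiff g (z n) p"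
      and we: "\<And>n. norm (w n + \<tau> *\<^sub>R (z n - xbar) - u) \<le> e n" by metis
    define w' where "w' n = w n + \<tau> *\<^sub>R (z n - xbar) - u" for n
    have w_eq: "w n = w' n + u - \<tau> *\<^sub>R (z n - xbar)" for n by (simp add: w'_def)
    have w'_lim: "w' \<longlonglongrightarrow> 0"
      by (rule Lim_null_comparison[OF _ e_lim]) (use we in \<open>simp add: w'_def\<close>)
    have z_near: "dist (z n) xbar < \<delta>" for n using z[of n] \<rho>'(3) \<delta> by linarith
    have w_near: "dist (w n) vhat < \<delta>" for n
    proof -
      have "w n - vhat = (w' n + (u - vhat)) - \<tau> *\<^sub>R (z n - xbar)" by (simp add: w_eq)
      then have "norm (w n - vhat) \<le> norm (w' n + (u - vhat)) + norm (\<tau> *\<^sub>R (z n - xbar))"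
        by (metis norm_triangle_ineq4)
      moreover have "norm (w' n + (u - vhat)) \<le> norm (w' n) + norm (u - vhat)"
        by (rule norm_triangle_ineq)
      moreover have "norm (\<tau> *\<^sub>R (z n - xbar)) = \<tau> * norm (z n - xbar)" using \<tau> by simp
      moreover have "\<tau> * norm (z n - xbar) \<le> \<tau> * \<rho>'"
        using z[of n] \<tau> by (intro mult_left_mono) (auto simp: dist_norm)
      moreover have "norm (w' n) \<le> \<delta> / 4" using we[of n] e(2)[of n] by (simp add: w'_def)
      ultimately show ?thesis using \<tau>\<rho> u d \<delta> unfolding dist_norm by linarith
    qed
    have p': "dist p pbar < \<delta>" using p d \<delta> by linarith
    have z_diff: "(\<tau> - r) * dist (z m) (z n) \<le> dist (w' m) (w' n)" for m n
    proof (cases "z m = z n")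
      case False
      have "- r * (norm (z m - z n))\<^sup>2 \<le> inner (w m - w n) (z m - z n)"
        by (rule partial_subdiff_hypomonotone[OF pri p' w z_near w_near w z_near w_near])
      also have "w m - w n = (w' m - w' n) - \<tau> *\<^sub>R (z m - z n)"
        by (simp add: w_eq scaleR_diff_right)
      also have "inner \<dots> (z m - z n) = inner (w' m - w' n) (z m - z n) - \<tau> * (norm (z m - z n))\<^sup>2"
        by (simp only: inner_diff_left[of "w' m - w' n"] inner_scaleR_left power2_norm_eq_inner)
      finally have "(\<tau> - r) * (norm (z m - z n))\<^sup>2 \<le> inner (w' m - w' n) (z m - z n)"
        by (simp add: algebra_simps)
      also have "\<dots> \<le> norm (w' m - w' n) * norm (z m - z n)" by (rule norm_cauchy_schwarz)
      finally have "((\<tau> - r) * norm (z m - z n)) * norm (z m - z n) \<le> norm (w' m - w' n) * norm (z m - z n)"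
        by (simp add: power2_eq_square mult.assoc)
      then show ?thesis using False by (simp add: dist_norm)
    qed simp
    have "Cauchy z"
    proof (rule metric_CauchyI)
      fix \<epsilon> :: real assume "\<epsilon> > 0"
      then have "(\<tau> - r) * \<epsilon> > 0" using \<tau> by simp
      moreover have "Cauchy w'" using w'_lim LIMSEQ_imp_Cauchy by blast
      ultimately obtain M where M: "\<And>m n. m \<ge> M \<Longrightarrow> n \<ge> M \<Longrightarrow> dist (w' m) (w' n) < (\<tau> - r) * \<epsilon>"
        using metric_CauchyD by metis
      have "dist (z m) (z n) < \<epsilon>" if "m \<ge> M" "n \<ge> M" for m n
      proof -
        have "(\<tau> - r) * dist (z m) (z n) < (\<tau> - r) * \<epsilon>"
          using z_diff[of m n] M[OF that] by linarith
        then show ?thesis using \<tau> by simp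
      qed
      then show "\<exists>M. \<forall>m\<ge>M. \<forall>n\<ge>M. dist (z m) (z n) < \<epsilon>" by blast
    qed
    then obtain x where x: "z \<longlonglongrightarrow> x" using Cauchy_convergent convergent_def by blast
    define v where "v = u - \<tau> *\<^sub>R (x - xbar)"
    have "(\<lambda>n. w' n + u - \<tau> *\<^sub>R (z n - xbar)) \<longlonglongrightarrow> 0 + u - \<tau> *\<^sub>R (x - xbar)"
      by (intro tendsto_intros w'_lim x)
    then have w_lim: "w \<longlonglongrightarrow> v" unfolding w_eq[symmetric] by (simp add: v_def)
    have "dist x xbar \<le> \<rho>'"
      using LIMSEQ_le_const2[OF tendsto_dist[OF x tendsto_const]] z less_imp_le by blast
    then have x_near: "dist x xbar < \<rho>" "dist x xbar < \<delta>" using \<rho>' \<rho> \<delta> by linarith+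
    have limit_ineq: "g (x, p) \<le> ereal (\<beta> - inner v (y - x) + r / 2 * (norm (y - x))\<^sup>2)"
      if y: "dist y xbar < \<delta>" "g (y, p) \<le> ereal \<beta>" for y \<beta>
    proof -
      define s where "s n = (z n, \<beta> - inner (w n) (y - z n) + r / 2 * (norm (y - z n))\<^sup>2)" for n
      have "s n \<in> ereal_epigraph (\<lambda>x. g (x, p))" for n
      proof -
        obtain a where a: "g (z n, p) = ereal a" using partial_subdiff_finite[OF w] by auto
        have "a + inner (w n) (y - z n) - r / 2 * (norm (y - z n))\<^sup>2 \<le> \<beta>"
          using uniform_prox_ineqD[OF pri w[of n] z_near[of n] p' w_near[of n] y] a by simp
        then show ?thesis using a by (simp add: s_def ereal_epigraph_def)
      qed
      moreover have "s \<longlonglongrightarrow> (x, \<beta> - inner v (y - x) + r / 2 * (norm (y - x))\<^sup>2)"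
        unfolding s_def by (intro tendsto_intros x w_lim)
      ultimately have "(x, \<beta> - inner v (y - x) + r / 2 * (norm (y - x))\<^sup>2) \<in> ereal_epigraph (\<lambda>x. g (x, p))"
        using lower_semicontinuous_imp_closed_epigraph[OF lsc] closed_sequentially by blast
      then show ?thesis by (simp add: ereal_epigraph_def)
    qed
    obtain a0 where "g (z 0, p) = ereal a0" using partial_subdiff_finite[OF w[of 0]] by auto
    with limit_ineq[OF z_near[of 0], of a0] g_not_minf[of "(x, p)"]
    obtain a where a: "g (x, p) = ereal a" by (cases "g (x, p)") auto
    have "v \<in> frechet_subdiff (\<lambda>x. g (x, p)) x"
    proof (rule proximal_imp_frechet_subdiff)
      show "\<bar>g (x, p)\<bar> \<noteq> \<infinity>" using a by simp
      show "\<delta> - dist x xbar > 0" using x_near by simp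
      fix y \<beta> assume "dist y x < \<delta> - dist x xbar" and \<beta>: "g (y, p) \<le> ereal \<beta>"
      then have "dist y xbar < \<delta>" using dist_triangle[of y xbar x] by linarith
      from limit_ineq[OF this \<beta>] a
      show "real_of_ereal (g (x, p)) + inner v (y - x) - r / 2 * (norm (y - x))\<^sup>2 \<le> \<beta>" by simp
    qed
    then have "v \<in> partial_subdiff g x p"
      using frechet_subset_limiting_subdiff by (auto simp: partial_subdiff_def)
    then show ?thesis using x_near(1) by (auto simp: v_def)
  qed
  then show ?thesis using d(1) by blast
qed

section \<open>The localization and the graph of the subdifferential\<close>

lemma mem_prox_map_iff:
  assumes "lam > 0"
  shows "x \<in> prox_map g lam (v, p) \<longleftrightarrow> (1 / lam) *\<^sub>R (v - x) \<in> partial_subdiff g x p"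
proof
  assume "(1 / lam) *\<^sub>R (v - x) \<in> partial_subdiff g x p"
  then show "x \<in> prox_map g lam (v, p)"
    using assms by (auto simp: prox_map_def image_iff intro!: bexI[of _ "(1 / lam) *\<^sub>R (v - x)"])
qed (use assms in \<open>auto simp: prox_map_def\<close>)

text \<open>
  A graph point \<open>(x, w)\<close> at \<open>p\<close> is moved to \<open>p'\<close> with \<open>v = x + lam w\<close> kept fixed. For equal data \<open>v\<close> the
  estimate says \<open>2 \<kappa> |\<pi>(v, p) - \<pi>(v, p')| \<le> l dist p p'\<close>.
\<close>

lemma prox_localization_imp_graph_lipschitz_like:
  fixes g :: "'x::real_inner \<times> 'p::metric_space \<Rightarrow> ereal"
  assumes lam: "lam > 0" and \<kappa>: "\<kappa> > 0" and l: "l > 0"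
    and loc: "single_valued_localization (prox_map g lam) (W \<times> P) U
        (lam *\<^sub>R vhat + xbar, pbar) xbar \<pi>"
    and est: "\<And>v1 v2 p1 p2. v1 \<in> W \<Longrightarrow> v2 \<in> W \<Longrightarrow> p1 \<in> P \<Longrightarrow> p2 \<in> P \<Longrightarrow>
        norm ((v1 - v2) - (2 * \<kappa>) *\<^sub>R (\<pi> (v1, p1) - \<pi> (v2, p2))) \<le> norm (v1 - v2) + l * dist p1 p2"
  shows "lipschitz_like (\<lambda>p. graph_of (\<lambda>x. partial_subdiff g x p)) pbar (xbar, vhat)"
proof -
  define v0 where "v0 = lam *\<^sub>R vhat + xbar"
  have base: "xbar \<in> prox_map g lam (v0, pbar)" "(v0, pbar) \<in> interior (W \<times> P)" "xbar \<in> interior U"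
    and gr: "\<And>v p x. v \<in> W \<Longrightarrow> p \<in> P \<Longrightarrow> x \<in> U \<Longrightarrow> x \<in> prox_map g lam (v, p) \<longleftrightarrow> x = \<pi> (v, p)"
    and \<pi>: "\<And>v p. v \<in> W \<Longrightarrow> p \<in> P \<Longrightarrow> \<pi> (v, p) \<in> prox_map g lam (v, p)"
    using loc unfolding single_valued_localization_def graph_of_def v0_def by (auto simp: set_eq_iff)
  obtain d1 d2 d3 where d: "d1 > 0" "ball v0 d1 \<subseteq> W" "d2 > 0" "ball pbar d2 \<subseteq> P" "d3 > 0" "ball xbar d3 \<subseteq> U"
    using base(2,3) by (auto simp: interior_Times mem_interior)
  define \<delta> where "\<delta> = Min {d1 / (1 + lam), d2, d3}"
  have \<delta>: "\<delta> > 0" "\<delta> \<le> d1 / (1 + lam)" "\<delta> \<le> d2" "\<delta> \<le> d3"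
    using d lam by (auto simp: \<delta>_def)
  have \<delta>1: "\<delta> * (1 + lam) \<le> d1" using \<delta>(2) lam by (simp add: pos_le_divide_eq)
  define L where "L = (1 + 1 / lam) * (l / (2 * \<kappa>))"
  have L: "L > 0" using lam l \<kappa> by (simp add: L_def add_pos_pos)
  have "\<exists>y'\<in>graph_of (\<lambda>x. partial_subdiff g x p'). dist y y' \<le> L * dist p p'"
    if p: "dist p pbar < \<delta>" "dist p' pbar < \<delta>" and y: "dist y (xbar, vhat) < \<delta>"
      and mem: "y \<in> graph_of (\<lambda>x. partial_subdiff g x p)" for p p' y
  proof -
    obtain x w where xw: "y = (x, w)" by (cases y)
    have w: "w \<in> partial_subdiff g x p" using mem by (simp add: xw graph_of_def)
    have xd: "dist x xbar < \<delta>" and wd: "dist w vhat < \<delta>"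
      using y dist_fst_le[of y "(xbar, vhat)"] dist_snd_le[of y "(xbar, vhat)"] by (auto simp: xw)
    define v where "v = x + lam *\<^sub>R w"
    have "norm (v - v0) = norm ((x - xbar) + lam *\<^sub>R (w - vhat))"
      by (simp add: v_def v0_def algebra_simps)
    also have "\<dots> \<le> norm (x - xbar) + lam * norm (w - vhat)"
      using norm_triangle_ineq[of "x - xbar" "lam *\<^sub>R (w - vhat)"] lam by simp
    also have "\<dots> < \<delta> + lam * \<delta>"
      using xd wd lam by (intro add_less_le_mono mult_left_mono) (auto simp: dist_norm)
    finally have "norm (v - v0) < d1" using \<delta>1 by (simp add: algebra_simps)
    then have vW: "v \<in> W" using d(2) by (auto simp: dist_norm norm_minus_commute)
    have pP: "p \<in> P" "p' \<in> P" and xU: "x \<in> U"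
      using p xd \<delta> d by (auto simp: subset_iff dist_commute)
    have "x \<in> prox_map g lam (v, p)" using w lam by (simp add: mem_prox_map_iff v_def)
    then have x: "x = \<pi> (v, p)" using gr[OF vW pP(1) xU] by simp
    define x' where "x' = \<pi> (v, p')"
    define w' where "w' = (1 / lam) *\<^sub>R (v - x')"
    have w': "w' \<in> partial_subdiff g x' p'"
      using \<pi>[OF vW pP(2)] lam by (simp add: mem_prox_map_iff w'_def x'_def)
    have "2 * \<kappa> * norm (x - x') \<le> l * dist p p'"
      using est[OF vW vW pP] \<kappa> by (simp add: x x'_def)
    then have dx: "norm (x - x') \<le> l / (2 * \<kappa>) * dist p p'"
      using \<kappa> by (simp add: pos_le_divide_eq mult.commute)
    have "w - w' = (1 / lam) *\<^sub>R (x' - x)"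
      using lam by (simp add: w'_def v_def algebra_simps)
    then have "norm (w - w') = 1 / lam * norm (x - x')"
      using lam by (simp add: norm_minus_commute)
    then have "dist y (x', w') \<le> (1 + 1 / lam) * norm (x - x')"
      using dist_Pair_le[of x w x' w'] by (simp add: xw dist_norm algebra_simps)
    also have "\<dots> \<le> (1 + 1 / lam) * (l / (2 * \<kappa>) * dist p p')"
      using dx lam by (intro mult_left_mono) auto
    also have "\<dots> = L * dist p p'" by (simp only: L_def mult.assoc)
    finally show ?thesis using w' by (intro bexI[of _ "(x', w')"]) (auto simp: graph_of_def)
  qed
  moreover have "(xbar, vhat) \<in> graph_of (\<lambda>x. partial_subdiff g x pbar)"
    using base(1) lam by (simp add: mem_prox_map_iff v0_def graph_of_def)
  ultimately show ?thesis unfolding lipschitz_like_iff_dist using L \<delta>(1) by blast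
qed

text \<open>Strong monotonicity in the norm form required of the localization.\<close>

lemma norm_diff_scaleR_le:
  fixes a b :: "'x::real_inner"
  assumes "\<kappa> \<ge> 0" and "\<kappa> * (norm b)\<^sup>2 \<le> inner a b"
  shows "norm (a - (2 * \<kappa>) *\<^sub>R b) \<le> norm a"
proof -
  have "(norm (a - (2 * \<kappa>) *\<^sub>R b))\<^sup>2 = (norm a)\<^sup>2 - 4 * \<kappa> * (inner a b - \<kappa> * (norm b)\<^sup>2)"
    by (simp add: power2_norm_eq_inner algebra_simps inner_commute)
  also have "\<dots> \<le> (norm a)\<^sup>2" using assms by simp
  finally show ?thesis by (rule power2_le_imp_le) simp
qed

text \<open>
  Existence comes from \<open>resolvent_points_exist\<close>, uniqueness from strong monotonicity. To compare
  solutions \<open>x1\<close>, \<open>x2\<close> at different parameters, the graph point \<open>(x1, w1)\<close> is replaced by a close one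
  \<open>(x', w')\<close> at the second parameter; then \<open>x'\<close> and \<open>x2\<close> obey the estimate for a common parameter, and
  the replacement costs a multiple of \<open>dist p1 p2\<close>. The radii are chosen so that the points \<open>(x', w')\<close>
  remain within \<open>m\<close> of \<open>(xbar, vhat)\<close>, where monotonicity is available.
\<close>

lemma graph_lipschitz_like_imp_prox_localization:
  fixes g :: "'x::{real_inner, complete_space} \<times> 'p::metric_space \<Rightarrow> ereal"
  assumes g_not_minf: "\<And>z. g z \<noteq> -\<infinity>" and lsc: "lower_semicontinuous g"
    and pri: "uniform_prox_ineq g xbar pbar vhat r \<delta>" and \<delta>: "\<delta> > 0" and r: "r \<ge> 0"
    and vhat: "vhat \<in> partial_subdiff g xbar pbar"
    and epi: "lipschitz_like (\<lambda>p. ereal_epigraph (\<lambda>x. g (x, p))) pbar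
      (xbar, real_of_ereal (g (xbar, pbar)))"
    and lam: "lam > 0" "lam * r < 1"
    and K: "lipschitz_like (\<lambda>p. graph_of (\<lambda>x. partial_subdiff g x p)) pbar (xbar, vhat)"
  shows "\<exists>W P U \<pi>. single_valued_localization (prox_map g lam) (W \<times> P) U
       (lam *\<^sub>R vhat + xbar, pbar) xbar \<pi> \<and>
     (\<exists>\<kappa>0>0. \<exists>l0>0. \<forall>v1\<in>W. \<forall>v2\<in>W. \<forall>p1\<in>P. \<forall>p2\<in>P.
        norm ((v1 - v2) - (2 * \<kappa>0) *\<^sub>R (\<pi> (v1, p1) - \<pi> (v2, p2))) \<le> norm (v1 - v2) + l0 * dist p1 p2)"
proof -
  obtain l \<delta>1 where l: "l > 0" "\<delta>1 > 0"
    and KL: "\<And>p p' y. dist p pbar < \<delta>1 \<Longrightarrow> dist p' pbar < \<delta>1 \<Longrightarrow> dist y (xbar, vhat) < \<delta>1 \<Longrightarrow>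
      y \<in> graph_of (\<lambda>x. partial_subdiff g x p) \<Longrightarrow>
      \<exists>y'\<in>graph_of (\<lambda>x. partial_subdiff g x p'). dist y y' \<le> l * dist p p'"
    using K unfolding lipschitz_like_iff_dist by blast
  define m where "m = min \<delta> \<delta>1"
  have m: "m > 0" "m \<le> \<delta>" "m \<le> \<delta>1" using \<delta> l by (auto simp: m_def)
  define v0 where "v0 = lam *\<^sub>R vhat + xbar"
  define \<rho> where "\<rho> = min (m / 8) (lam * (m / 8))"
  have \<rho>: "\<rho> > 0" "\<rho> \<le> m / 8" "\<rho> / lam \<le> m / 8"
    using m lam by (auto simp: \<rho>_def pos_divide_le_eq mult.commute)
  have \<tau>: "1 / lam > 0" "r < 1 / lam" using lam by (simp_all add: pos_less_divide_eq mult.commute)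
  obtain d0 where d0: "d0 > 0" and ex:
    "\<And>u p. norm (u - vhat) < d0 \<Longrightarrow> dist p pbar < d0 \<Longrightarrow>
      \<exists>x. dist x xbar < \<rho> \<and> u - (1 / lam) *\<^sub>R (x - xbar) \<in> partial_subdiff g x p"
    using resolvent_points_exist[OF g_not_minf lsc pri \<delta> r vhat epi \<tau> \<rho>(1)] by blast
  define d where "d = Min {lam * d0, d0, lam * (m / 8), m / 8, m / 16 / l}"
  have d: "d > 0" "d \<le> lam * d0" "d \<le> d0" "d \<le> lam * (m / 8)" "d \<le> m / 8" "d \<le> m / 16 / l"
    using lam d0 m l by (auto simp: d_def)
  have dl: "l * d \<le> m / 16" and dlam: "d / lam \<le> m / 8" 
    using d(4,6) l lam by (simp_all add: pos_le_divide_eq pos_divide_le_eq mult.commute)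
  define W P U where "W = ball v0 d" and "P = ball pbar d" and "U = ball xbar \<rho>"
  define S where "S v p x \<longleftrightarrow> x \<in> U \<and> (1 / lam) *\<^sub>R (v - x) \<in> partial_subdiff g x p" for v p x
  have exS: "\<exists>x. S v p x" if v: "v \<in> W" and p: "p \<in> P" for v p
  proof -
    have "norm ((1 / lam) *\<^sub>R (v - v0)) < d0"
      using v d(2) lam by (simp add: W_def dist_norm norm_minus_commute pos_divide_less_eq mult.commute)
    also have "(1 / lam) *\<^sub>R (v - v0) = (1 / lam) *\<^sub>R (v - xbar) - vhat"
      using lam by (simp add: v0_def algebra_simps)
    finally obtain x where x: "dist x xbar < \<rho>"
        "(1 / lam) *\<^sub>R (v - xbar) - (1 / lam) *\<^sub>R (x - xbar) \<in> partial_subdiff g x p"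
      using ex[of "(1 / lam) *\<^sub>R (v - xbar)" p] p d(3) by (auto simp: P_def dist_commute)
    have "(1 / lam) *\<^sub>R (v - xbar) - (1 / lam) *\<^sub>R (x - xbar) = (1 / lam) *\<^sub>R (v - x)"
      by (simp add: algebra_simps)
    then show ?thesis using x by (auto simp: S_def U_def dist_commute)
  qed
  have w_near: "dist ((1 / lam) *\<^sub>R (v - x)) vhat < m / 4" if "v \<in> W" "x \<in> U" for v x
  proof -
    have "(1 / lam) *\<^sub>R (v - x) - vhat = (1 / lam) *\<^sub>R ((v - v0) - (x - xbar))"
      using lam by (simp add: v0_def algebra_simps)
    then have "dist ((1 / lam) *\<^sub>R (v - x)) vhat = norm ((v - v0) - (x - xbar)) / lam"
      using lam by (simp add: dist_norm)
    also have "\<dots> < (d + \<rho>) / lam"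
      using that lam norm_triangle_ineq4[of "v - v0" "x - xbar"]
      by (intro divide_strict_right_mono) (auto simp: W_def U_def dist_norm norm_minus_commute)
    also have "\<dots> \<le> m / 4" using dlam \<rho>(3) unfolding add_divide_distrib by linarith
    finally show ?thesis .
  qed
  have mono: "(1 - lam * r) * (norm (x1 - x2))\<^sup>2 \<le> inner ((x1 + lam *\<^sub>R w1) - (x2 + lam *\<^sub>R w2)) (x1 - x2)"
    if "p \<in> P" "w1 \<in> partial_subdiff g x1 p" "dist x1 xbar < m" "dist w1 vhat < m"
       "w2 \<in> partial_subdiff g x2 p" "dist x2 xbar < m" "dist w2 vhat < m" for p x1 x2 w1 w2
  proof -
    have "dist p pbar < \<delta>" using that(1) d(5) m by (simp add: P_def dist_commute)
    then have "- r * (norm (x1 - x2))\<^sup>2 \<le> inner (w1 - w2) (x1 - x2)"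
      using that m by (intro partial_subdiff_hypomonotone[OF pri]) auto
    then have "lam * (- r * (norm (x1 - x2))\<^sup>2) \<le> lam * inner (w1 - w2) (x1 - x2)"
      using lam by (intro mult_left_mono) auto
    moreover have "inner ((x1 + lam *\<^sub>R w1) - (x2 + lam *\<^sub>R w2)) (x1 - x2)
        = (norm (x1 - x2))\<^sup>2 + lam * inner (w1 - w2) (x1 - x2)"
      by (simp add: power2_norm_eq_inner algebra_simps)
    ultimately show ?thesis by (simp add: algebra_simps)
  qed
  define \<kappa> where "\<kappa> = 1 - lam * r"
  have \<kappa>: "\<kappa> > 0" using lam by (simp add: \<kappa>_def)
  have point: "x + lam *\<^sub>R ((1 / lam) *\<^sub>R (v - x)) = v" for v x :: 'x using lam by simp
  have U_near: "dist x xbar < m / 8" if "x \<in> U" for x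
    using that \<rho>(2) by (simp add: U_def dist_commute)
  have unique: "x1 = x2" if S: "S v p x1" "S v p x2" and v: "v \<in> W" and p: "p \<in> P" for v p x1 x2
  proof -
    have "\<kappa> * (norm (x1 - x2))\<^sup>2 \<le> 0"
      using mono[of p "(1 / lam) *\<^sub>R (v - x1)" x1 "(1 / lam) *\<^sub>R (v - x2)" x2] p S v
        U_near[of x1] U_near[of x2] w_near[of v x1] w_near[of v x2] m(1)
      unfolding point S_def \<kappa>_def by simp
    then show ?thesis using \<kappa> by (simp add: mult_le_0_iff)
  qed
  define \<pi> where "\<pi> = (\<lambda>(v, p). SOME x. S v p x)"
  have \<pi>: "S v p (\<pi> (v, p))" if "v \<in> W" "p \<in> P" for v p
    unfolding \<pi>_def using someI_ex[OF exS[OF that]] by simp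
  have "single_valued_localization (prox_map g lam) (W \<times> P) U (v0, pbar) xbar \<pi>"
    unfolding single_valued_localization_def
  proof (intro conjI)
    show "((v0, pbar), xbar) \<in> graph_of (prox_map g lam)"
      using vhat lam by (simp add: graph_of_def mem_prox_map_iff v0_def)
    show "(v0, pbar) \<in> interior (W \<times> P)" "xbar \<in> interior U"
      using d(1) \<rho>(1) by (simp_all add: W_def P_def U_def interior_Times)
    show "\<pi> ` (W \<times> P) \<subseteq> U" using \<pi> by (auto simp: S_def)
    show "{(y, \<pi> y) |y. y \<in> W \<times> P} = graph_of (prox_map g lam) \<inter> ((W \<times> P) \<times> U)"
    proof (intro set_eqI iffI)
      fix t assume "t \<in> {(y, \<pi> y) |y. y \<in> W \<times> P}"
      then show "t \<in> graph_of (prox_map g lam) \<inter> ((W \<times> P) \<times> U)"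
        using \<pi> lam by (auto simp: graph_of_def mem_prox_map_iff S_def)
    next
      fix t assume t: "t \<in> graph_of (prox_map g lam) \<inter> ((W \<times> P) \<times> U)"
      then obtain v p x where "t = ((v, p), x)" "v \<in> W" "p \<in> P" "S v p x"
        using lam by (auto simp: graph_of_def mem_prox_map_iff S_def)
      then show "t \<in> {(y, \<pi> y) |y. y \<in> W \<times> P}" using unique[OF _ \<pi>] by auto
    qed
  qed
  moreover
  define l0 where "l0 = (2 * (1 + lam) + 2 * \<kappa>) * l"
  have l0: "l0 > 0" using lam \<kappa> l by (simp add: l0_def)
  have "norm ((v1 - v2) - (2 * \<kappa>) *\<^sub>R (\<pi> (v1, p1) - \<pi> (v2, p2))) \<le> norm (v1 - v2) + l0 * dist p1 p2"
    if v: "v1 \<in> W" "v2 \<in> W" and p: "p1 \<in> P" "p2 \<in> P" for v1 v2 p1 p2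
  proof -
    define x1 w1 x2 w2 where "x1 = \<pi> (v1, p1)" and "w1 = (1 / lam) *\<^sub>R (v1 - x1)"
      and "x2 = \<pi> (v2, p2)" and "w2 = (1 / lam) *\<^sub>R (v2 - x2)"
    have 1: "w1 \<in> partial_subdiff g x1 p1" "dist x1 xbar < m / 8" "dist w1 vhat < m / 4"
      using \<pi>[OF v(1) p(1)] U_near[of x1] w_near[OF v(1), of x1] by (auto simp: S_def x1_def w1_def)
    have 2: "w2 \<in> partial_subdiff g x2 p2" "dist x2 xbar < m / 8" "dist w2 vhat < m / 4"
      using \<pi>[OF v(2) p(2)] U_near[of x2] w_near[OF v(2), of x2] by (auto simp: S_def x2_def w2_def)
    have pd: "dist p1 pbar < d" "dist p2 pbar < d" using p by (auto simp: P_def dist_commute)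
    define t where "t = l * dist p1 p2"
    have "dist p1 p2 \<le> 2 * d" using dist_triangle2[of p1 p2 pbar] pd by linarith
    then have "t \<le> l * (2 * d)" unfolding t_def using l by (intro mult_left_mono) auto
    then have t: "t \<le> m / 8" using dl by simp
    have "dist (x1, w1) (xbar, vhat) < \<delta>1"
      using dist_Pair_le[of x1 w1 xbar vhat] 1 m by linarith
    then obtain y' where y': "y' \<in> graph_of (\<lambda>x. partial_subdiff g x p2)" "dist (x1, w1) y' \<le> t"
      using KL[of p1 p2 "(x1, w1)"] pd d(5) m 1 by (auto simp: graph_of_def t_def)
    define x' w' where "x' = fst y'" and "w' = snd y'"
    have w': "w' \<in> partial_subdiff g x' p2"
      using y'(1) by (auto simp: graph_of_def x'_def w'_def)
    have dx: "norm (x1 - x') \<le> t" and dw: "norm (w1 - w') \<le> t"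
      using y'(2) dist_fst_le[of "(x1, w1)" y'] dist_snd_le[of "(x1, w1)" y']
      by (auto simp: x'_def w'_def dist_norm)
    have near': "dist x' xbar < m" "dist w' vhat < m"
      using dist_triangle3[of x' xbar x1] dist_triangle3[of w' vhat w1] dx dw t 1 m
      by (auto simp: dist_norm)
    define v' where "v' = x' + lam *\<^sub>R w'"
    have "v1 - v' = (x1 - x') + lam *\<^sub>R (w1 - w')"
      using lam by (simp add: v'_def w1_def algebra_simps)
    then have "norm (v1 - v') \<le> norm (x1 - x') + lam * norm (w1 - w')"
      using norm_triangle_ineq[of "x1 - x'" "lam *\<^sub>R (w1 - w')"] lam by simp
    also have "\<dots> \<le> t + lam * t" using dx dw lam by (intro add_mono mult_left_mono) auto
    finally have dv: "norm (v1 - v') \<le> (1 + lam) * t" by (simp add: algebra_simps)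
    have "\<kappa> * (norm (x' - x2))\<^sup>2 \<le> inner (v' - v2) (x' - x2)"
      using mono[OF p(2) w' near' 2(1)] 2 m(1) point[of x2 v2]
      by (simp add: \<kappa>_def v'_def w2_def)
    then have core: "norm ((v' - v2) - (2 * \<kappa>) *\<^sub>R (x' - x2)) \<le> norm (v' - v2)"
      using \<kappa> by (intro norm_diff_scaleR_le) auto
    have "(v1 - v2) - (2 * \<kappa>) *\<^sub>R (x1 - x2)
        = ((v' - v2) - (2 * \<kappa>) *\<^sub>R (x' - x2)) + ((v1 - v') - (2 * \<kappa>) *\<^sub>R (x1 - x'))"
      by (simp add: algebra_simps)
    then have "norm ((v1 - v2) - (2 * \<kappa>) *\<^sub>R (x1 - x2))
        \<le> norm ((v' - v2) - (2 * \<kappa>) *\<^sub>R (x' - x2)) + norm ((v1 - v') - (2 * \<kappa>) *\<^sub>R (x1 - x'))"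
      by (simp only: norm_triangle_ineq)
    also note core
    also have "norm ((v1 - v') - (2 * \<kappa>) *\<^sub>R (x1 - x')) \<le> norm (v1 - v') + 2 * \<kappa> * norm (x1 - x')"
      using norm_triangle_ineq4[of "v1 - v'" "(2 * \<kappa>) *\<^sub>R (x1 - x')"] \<kappa> by simp
    also have "2 * \<kappa> * norm (x1 - x') \<le> 2 * \<kappa> * t" using dx \<kappa> by (intro mult_left_mono) auto
    also have "norm (v' - v2) \<le> norm (v1 - v2) + norm (v1 - v')"
      using norm_triangle_ineq[of "v1 - v2" "v' - v1"] by (simp add: norm_minus_commute)
    finally have "norm ((v1 - v2) - (2 * \<kappa>) *\<^sub>R (x1 - x2)) \<le> norm (v1 - v2) + (2 * ((1 + lam) * t) + 2 * \<kappa> * t)"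
      using dv by linarith
    also have "2 * ((1 + lam) * t) + 2 * \<kappa> * t = l0 * dist p1 p2"
      by (simp add: l0_def t_def algebra_simps)
    finally show ?thesis by (simp add: x1_def x2_def)
  qed
  ultimately show ?thesis using \<kappa> l0 unfolding v0_def by blast
qed

lemma prox_threshold_nonneg:
  assumes "param_cont_prox_regular g xbar pbar vhat"
  shows "0 \<le> prox_threshold g xbar pbar vhat"
  unfolding prox_threshold_def using assms
  by (intro cInf_greatest) (auto simp: param_cont_prox_regular_def)

lemma less_inverse_ereal_iff:
  assumes "0 \<le> R" and "0 < lam"
  shows "ereal lam < inverse (ereal R) \<longleftrightarrow> lam * R < 1"
  using assms by (cases "R = 0") (auto simp: field_simps)

theorem theorem6p5:
  fixes f :: "'x::{real_inner, complete_space} \<times> 'p::metric_space \<times> 'q::metric_space \<Rightarrow> 'x"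
    and g :: "'x \<times> 'p \<Rightarrow> ereal"
    and xbar vbar vhat :: 'x and pbar :: 'p and qbar :: 'q
  assumes g_not_minf: "\<And>z. g z \<noteq> -\<infinity>"
    and g_lsc: "lower_semicontinuous g"
    and vbar: "vbar \<in> (\<lambda>w. f (xbar, pbar, qbar) + w) ` partial_subdiff g xbar pbar"
    and vhat: "vhat = vbar - f (xbar, pbar, qbar)"
    and A2: "param_cont_prox_regular g xbar pbar vhat"
    and A3: "lipschitz_like (\<lambda>p. ereal_epigraph (\<lambda>x. g (x, p))) pbar (xbar, real_of_ereal (g (xbar, pbar)))"
  shows "(\<forall>lam>0. ereal lam < inverse (ereal (prox_threshold g xbar pbar vhat)) \<longrightarrow>
            (\<exists>W P U \<pi>.
               single_valued_localization (prox_map g lam) (W \<times> P) U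
                 (lam *\<^sub>R vhat + xbar, pbar) xbar \<pi> \<and>
               (\<exists>\<kappa>0>0. \<exists>l0>0. \<forall>v1\<in>W. \<forall>v2\<in>W. \<forall>p1\<in>P. \<forall>p2\<in>P.
                  norm ((v1 - v2) - (2 * \<kappa>0) *\<^sub>R (\<pi> (v1, p1) - \<pi> (v2, p2)))
                    \<le> norm (v1 - v2) + l0 * dist p1 p2)))
         \<longleftrightarrow>
         lipschitz_like (\<lambda>p. graph_of (\<lambda>x. partial_subdiff g x p)) pbar (xbar, vhat)"
    (is "?loc \<longleftrightarrow> ?lip")
proof
  define R where "R = prox_threshold g xbar pbar vhat"
  have R: "R \<ge> 0" using prox_threshold_nonneg[OF A2] by (simp add: R_def)
  assume ?loc
  \<comment> \<open>Any admissible value of \<open>lam\<close> will do; this one covers \<open>R = 0\<close> as well.\<close>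
  define lam where "lam = 1 / (R + 1)"
  have "lam > 0" "lam * R < 1" using R by (simp_all add: lam_def)
  then obtain W P U \<pi> \<kappa>0 l0 where "single_valued_localization (prox_map g lam) (W \<times> P) U
       (lam *\<^sub>R vhat + xbar, pbar) xbar \<pi>" "\<kappa>0 > 0" "l0 > 0"
     "\<forall>v1\<in>W. \<forall>v2\<in>W. \<forall>p1\<in>P. \<forall>p2\<in>P.
        norm ((v1 - v2) - (2 * \<kappa>0) *\<^sub>R (\<pi> (v1, p1) - \<pi> (v2, p2))) \<le> norm (v1 - v2) + l0 * dist p1 p2"
    using \<open>?loc\<close> less_inverse_ereal_iff[OF R] unfolding R_def[symmetric] by blast
  then show ?lip
    using \<open>lam > 0\<close> by (intro prox_localization_imp_graph_lipschitz_like[of lam \<kappa>0 l0]) auto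
next
  define R where "R = prox_threshold g xbar pbar vhat"
  have R: "R \<ge> 0" using prox_threshold_nonneg[OF A2] by (simp add: R_def)
  assume ?lip
  have vhat_mem: "vhat \<in> partial_subdiff g xbar pbar" using vbar vhat by auto
  show ?loc
  proof (intro allI impI)
    fix lam :: real
    assume lam: "0 < lam" "ereal lam < inverse (ereal (prox_threshold g xbar pbar vhat))"
    then have "R < 1 / lam"
      using less_inverse_ereal_iff[OF R lam(1)] by (simp add: R_def pos_less_divide_eq mult.commute)
    then obtain r where r: "r > 0" "prox_regular_with g xbar pbar vhat r" "r < 1 / lam"
      using A2 unfolding R_def prox_threshold_def param_cont_prox_regular_def
      by (subst (asm) cInf_less_iff) (auto intro: bdd_belowI[of _ 0])
    have lr: "lam * r < 1" using r(3) lam(1) by (simp add: pos_less_divide_eq mult.commute)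
    obtain \<delta> where \<delta>: "\<delta> > 0" "uniform_prox_ineq g xbar pbar vhat r \<delta>"
      using uniform_prox_ineq_exists[OF vhat_mem r(2) A2] by blast
    show "\<exists>W P U \<pi>. single_valued_localization (prox_map g lam) (W \<times> P) U
         (lam *\<^sub>R vhat + xbar, pbar) xbar \<pi> \<and>
       (\<exists>\<kappa>0>0. \<exists>l0>0. \<forall>v1\<in>W. \<forall>v2\<in>W. \<forall>p1\<in>P. \<forall>p2\<in>P.
          norm ((v1 - v2) - (2 * \<kappa>0) *\<^sub>R (\<pi> (v1, p1) - \<pi> (v2, p2))) \<le> norm (v1 - v2) + l0 * dist p1 p2)"
      using r(1) by (intro graph_lipschitz_like_imp_prox_localization[OF g_not_minf g_lsc \<delta>(2,1) _
          vhat_mem A3 lam(1) lr \<open>?lip\<close>]) simp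
  qed
qed

end
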